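(* Let $\theta>0$, $d\geq1$, let $\overline{z}=(z_1,\dots,z_d)$ be a $\mathbb{T}^d$-valued random variable such that $z_1,\dots,z_d$ are uniformly distributed on $\mathbb{T}=\{w\in\mathbb{C}:|w|=1\}$ and independent, and let $x_1=e^{2\pi i\varphi_1},\dots,x_d=e^{2\pi i\varphi_d}\in\mathbb{T}$ be such that $1,\varphi_1,\dots,\varphi_d$ are linearly independent over $\mathbb{Z}$. For each $n\geq 1$ let $\sigma\in S_n$ be distributed according to the Ewens distribution with parameter $\theta$, and let $\log(Z_{n,z_j}(x_j))$, $1\leq j\leq d$, be the jointly defined random variables given in the context. Then, as $n\to\infty$, $$\frac{1}{\sqrt{\frac{\pi^2}{12}\theta\log n}}\bigl(\log(Z_{n,z_1}(x_1)),\dots,\log(Z_{n,z_d}(x_d))\bigr)\stackrel{d}{\longrightarrow}(N_1,\dots,N_d),$$ where $\mathrm{Re}(N_1),\dots,\mathrm{Re}(N_d),\mathrm{Im}(N_1),\dots,\mathrm{Im}(N_d)$ are independent standard normal random variables.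
   Context: Ewens distribution with parameter $\theta>0$ on the symmetric group $S_n$: $\mathbb{P}_\theta[\sigma]=\frac{\theta^{l_\sigma}}{\theta(\theta+1)\cdots(\theta+n-1)}$, where $l_\sigma$ is the total number of cycles of $\sigma$. $C_m=C_m(\sigma)$ denotes the number of cycles of length $m$ in $\sigma$. Given a $\mathbb{T}^d$-valued random variable $\overline z=(z_1,\dots,z_d)$, let $\overline T^{(m,k)}=(T_1^{(m,k)},\dots,T_d^{(m,k)})$, $m,k\geq1$, be independent (over the pairs $(m,k)$) random vectors, independent of $\sigma$, such that $\overline T^{(m,k)}$ has the law of the componentwise product of $m$ i.i.d. copies of $\overline z$. Set, with the same $\sigma$ for all $j$, $$\log(Z_{n,z_j}(x_j)):=\sum_{m=1}^n\sum_{k=1}^{C_m}\log\bigl(1-x_j^{-m}T_j^{(m,k)}\bigr),\qquad 1\leq j\leq d,$$ where $\log$ on the right is the principal branch, with $\log(-y)=\log y+i\pi$ for $y>0$ (the argument $0$ occurs only with probability $0$). Convergence in law is in $\mathbb{C}^d\cong\mathbb{R}^{2d}$. *)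

theory Defs
  imports "HOL-Probability.Probability" "HOL-Combinatorics.Orbits"
begin

abbreviation S_n :: "nat \<Rightarrow> (nat \<Rightarrow> nat) set" where
  "S_n n \<equiv> {\<sigma>. \<sigma> permutes {1..n}}"

text \<open>The cycles of a permutation of \<open>{1..n}\<close>, as sets of points; fixed points count as
  cycles of length 1.\<close>

definition cycles :: "nat \<Rightarrow> (nat \<Rightarrow> nat) \<Rightarrow> nat set set" where
  "cycles n \<sigma> = orbit \<sigma> ` {1..n}"

definition num_cycles :: "nat \<Rightarrow> (nat \<Rightarrow> nat) \<Rightarrow> nat" where
  "num_cycles n \<sigma> = card (cycles n \<sigma>)"

definition num_cycles_of_length :: "nat \<Rightarrow> (nat \<Rightarrow> nat) \<Rightarrow> nat \<Rightarrow> nat" where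
  "num_cycles_of_length n \<sigma> m = card {c \<in> cycles n \<sigma>. card c = m}"

definition ewens :: "real \<Rightarrow> nat \<Rightarrow> (nat \<Rightarrow> nat) measure" where
  "ewens \<theta> n =
     point_measure (S_n n) (\<lambda>\<sigma>. ennreal (\<theta> ^ num_cycles n \<sigma> / pochhammer \<theta> n))"

definition uniform_circle :: "complex measure" where
  "uniform_circle = distr (uniform_measure lborel {0..1}) borel (\<lambda>t::real. cis (2 * pi * t))"

text \<open>The law of the componentwise product of \<open>m\<close> i.i.d. random vectors with law \<open>\<mu>\<close>.\<close>

definition iid_product_law :: "(complex ^ 'd) measure \<Rightarrow> nat \<Rightarrow> (complex ^ 'd::finite) measure" where
  "iid_product_law \<mu> m =
     distr (\<Pi>\<^sub>M i\<in>{1..m}. \<mu>) borel (\<lambda>w. \<chi> j. \<Prod>i\<in>{1..m}. w i $ j)"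

text \<open>The library's \<open>Ln\<close> takes its imaginary part in \<open>(-\<pi>, \<pi>]\<close>, so that
  \<open>Ln (- y) = ln y + \<i> * \<pi>\<close> for \<open>y > 0\<close>.\<close>

definition log_Z :: "nat \<Rightarrow> (nat \<Rightarrow> nat) \<Rightarrow> (nat \<Rightarrow> nat \<Rightarrow> complex) \<Rightarrow> complex \<Rightarrow> complex" where
  "log_Z n \<sigma> t x =
     (\<Sum>m=1..n. \<Sum>k=1..num_cycles_of_length n \<sigma> m. Ln (1 - x powi (- int m) * t m k))"

text \<open>Independence of two random variables. The library's \<open>indep_var\<close> forces both to take values
  in the same type.\<close>

definition indep_rv ::
    "'w measure \<Rightarrow> 'a measure \<Rightarrow> ('w \<Rightarrow> 'a) \<Rightarrow> 'b measure \<Rightarrow> ('w \<Rightarrow> 'b) \<Rightarrow> bool" where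
  "indep_rv M A X B Y \<longleftrightarrow>
     X \<in> M \<rightarrow>\<^sub>M A \<and> Y \<in> M \<rightarrow>\<^sub>M B \<and>
     prob_space.indep_set M
       (sets (vimage_algebra (space M) X A)) (sets (vimage_algebra (space M) Y B))"

text \<open>Weak convergence of probability measures on a topological space; the library's
  \<open>weak_conv_m\<close> is restricted to the real line.\<close>

definition weakly_converges ::
    "(nat \<Rightarrow> 'a::topological_space measure) \<Rightarrow> 'a measure \<Rightarrow> bool" where
  "weakly_converges \<mu> \<nu> \<longleftrightarrow>
     (\<forall>f::'a \<Rightarrow> real. continuous_on UNIV f \<and> bounded (range f) \<longrightarrow>
        (\<lambda>n. \<integral>x. f x \<partial>\<mu> n) \<longlonglongrightarrow> (\<integral>x. f x \<partial>\<nu>))"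

end

theory Submission
  imports Defs "HOL-Complex_Analysis.Cauchy_Integral_Formula" "HOL-Real_Asymp.Real_Asymp"
begin

text \<open>
  The point \<open>x\<^sub>j\<close> only rotates. Each \<open>T\<^sup>(\<^sup>m\<^sup>,\<^sup>k\<^sup>)\<close> is uniform on the torus, because a product of independent
  uniform points is uniform, and so is its rotation by \<open>x\<^sub>j\<^sup>-\<^sup>m\<close>, whatever \<open>m\<close> is. Given \<open>\<sigma>\<close>, the vector
  \<open>log Z\<close> is therefore a sum of i.i.d. copies of \<open>(Ln (1 - U\<^sub>1), \<dots>, Ln (1 - U\<^sub>d))\<close> with \<open>U\<close> uniform on the
  torus, one copy for each cycle of \<open>\<sigma>\<close>: only the total number \<open>K\<^sub>n\<close> of cycles matters, not their lengths.

  One summand is centred, with covariance \<open>\<pi>\<^sup>2/12\<close> times the identity of \<open>\<real>\<^sup>2\<^sup>d\<close>. Its \<open>d\<close> complex components are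
  independent, as those of \<open>U\<close> are. Within one component the reason is that \<open>Ln (1 - z)\<close> and its square are holomorphic
  on the unit disc and vanish at \<open>0\<close>, so both have mean \<open>0\<close> over the circle. The real and imaginary parts of the mean of the square say that real part and
  imaginary part of \<open>Ln (1 - U)\<close> have the same variance and are uncorrelated; and the imaginary part is
  uniform on an interval of length \<open>\<pi>\<close> (lemma \<open>Ln_projection_moments\<close>).

  The generating function of \<open>K\<^sub>n\<close> is explicit: its value at \<open>u\<close> is \<open>(\<theta>u)(\<theta>u + 1)\<cdots>(\<theta>u + n - 1)\<close> divided
  by \<open>\<theta>(\<theta> + 1)\<cdots>(\<theta> + n - 1)\<close> (lemma \<open>ewens_generating_function\<close>). Substituting for \<open>u\<close> the characteristic
  function of one summand at \<open>t / \<surd>(\<pi>\<^sup>2/12 \<theta> log n)\<close> gives the characteristic function of the normalised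
  vector in closed form (lemma \<open>char_log_Z\<close>). Here \<open>u = 1 - \<bar>t\<bar>\<^sup>2 / (2 \<theta> log n) + o(1 / log n)\<close>, and the
  ratio of rising factorials behaves like \<open>n\<close> to the power \<open>\<theta> (u - 1)\<close>, hence tends to \<open>exp (- \<bar>t\<bar>\<^sup>2 / 2)\<close>
  (lemmas \<open>pochhammer_ratio_limit\<close> and \<open>ewens_char_limit\<close>).

  The limit is the characteristic function of \<open>N\<close>, and the continuity theorem in a Euclidean space
  (theorem \<open>levy_continuity_euclidean\<close>) turns this into convergence in law. It is derived from the
  one-dimensional theorem, which gives tightness of the coordinates, together with the
  Stone-Weierstrass theorem.
\<close>

section \<open>Continuity theorem in Euclidean spaces\<close>

text \<open>
  Finite complex linear combinations of characters \<open>x \<mapsto> exp (i t \<bullet> x)\<close>: the functions whose integrals are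
  controlled by the characteristic function.
\<close>
inductive trig_polynomial :: "('a::euclidean_space \<Rightarrow> complex) \<Rightarrow> bool" where
  iexp: "trig_polynomial (\<lambda>x. iexp (t \<bullet> x))"
| scale: "trig_polynomial f \<Longrightarrow> trig_polynomial (\<lambda>x. c * f x)"
| add: "trig_polynomial f \<Longrightarrow> trig_polynomial g \<Longrightarrow> trig_polynomial (\<lambda>x. f x + g x)"

lemma trig_polynomial_const: "trig_polynomial (\<lambda>x. c)"
  using trig_polynomial.scale[OF trig_polynomial.iexp[of 0], of c] by simp

lemma trig_polynomial_mult:
  assumes "trig_polynomial f" "trig_polynomial g"
  shows "trig_polynomial (\<lambda>x. f x * g x)"
  using assms(1)
proof (induction f)
  case (iexp t)
  from assms(2) show ?case
  proof (induction g)
    case (iexp s)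
    have "(\<lambda>x. iexp (t \<bullet> x) * iexp (s \<bullet> x)) = (\<lambda>x. iexp ((t + s) \<bullet> x))"
      by (simp add: inner_add_left exp_add distrib_left)
    then show ?case
      by (simp only: trig_polynomial.iexp)
  next
    case (scale f c)
    from trig_polynomial.scale[OF scale.IH, of c] show ?case
      by (simp only: mult.left_commute)
  next
    case (add f g)
    from trig_polynomial.add[OF add.IH] show ?case
      by (simp only: distrib_left)
  qed
next
  case (scale f c)
  from trig_polynomial.scale[OF scale.IH, of c] show ?case
    by (simp only: mult.assoc)
next
  case (add f g)
  from trig_polynomial.add[OF add.IH] show ?case
    by (simp only: distrib_right)
qed

lemma trig_polynomial_sum:
  assumes "finite I" "\<And>i. i \<in> I \<Longrightarrow> trig_polynomial (f i)"
  shows "trig_polynomial (\<lambda>x. \<Sum>i\<in>I. f i x)"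
  using assms by (induction I rule: finite_induct)
    (simp_all add: trig_polynomial_const trig_polynomial.add)

lemma trig_polynomial_sin: "trig_polynomial (\<lambda>x. of_real (sin (t \<bullet> x)))"
proof -
  have "trig_polynomial (\<lambda>x. 1 / (2 * \<i>) * iexp (t \<bullet> x) + (- 1 / (2 * \<i>)) * iexp ((- t) \<bullet> x))"
    by (intro trig_polynomial.intros)
  moreover have "complex_of_real (sin (t \<bullet> x))
      = 1 / (2 * \<i>) * iexp (t \<bullet> x) + (- 1 / (2 * \<i>)) * iexp ((- t) \<bullet> x)" for x
    by (simp add: sin_of_real[symmetric] sin_exp_eq field_simps)
  ultimately show ?thesis
    by simp
qed

lemma trig_polynomial_bounded_continuous:
  assumes "trig_polynomial f"
  shows "continuous_on UNIV f \<and> (\<exists>B. \<forall>x. norm (f x) \<le> B)"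
  using assms
proof (induction f)
  case (iexp t)
  have "continuous_on UNIV (\<lambda>x. iexp (t \<bullet> x))"
    by (intro continuous_intros)
  moreover have "\<forall>x. norm (iexp (t \<bullet> x)) \<le> 1" by simp
  ultimately show ?case by blast
next
  case (scale f c)
  then obtain B where B: "\<forall>x. norm (f x) \<le> B" by blast
  have "continuous_on UNIV (\<lambda>x. c * f x)"
    using scale by (intro continuous_intros) auto
  moreover have "\<forall>x. norm (c * f x) \<le> norm c * B"
    using B by (simp add: norm_mult mult_left_mono)
  ultimately show ?case by blast
next
  case (add f g)
  then obtain B C where B: "\<forall>x. norm (f x) \<le> B" "\<forall>x. norm (g x) \<le> C" by blast
  have "continuous_on UNIV (\<lambda>x. f x + g x)"
    using add by (intro continuous_intros) auto
  moreover have "\<forall>x. norm (f x + g x) \<le> B + C"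
    using B by (meson add_mono norm_triangle_le)
  ultimately show ?case by blast
qed

lemma integrable_bounded_continuous:
  fixes f :: "'a::euclidean_space \<Rightarrow> 'b::{banach, second_countable_topology}"
  assumes "prob_space \<mu>" "sets \<mu> = sets borel" "continuous_on UNIV f" "\<And>x. norm (f x) \<le> B"
  shows "integrable \<mu> f"
proof -
  interpret prob_space \<mu> by fact
  have "f \<in> borel_measurable \<mu>"
    using borel_measurable_continuous_onI[OF assms(3)] assms(2)
    by (simp cong: measurable_cong_sets)
  then show ?thesis
    using assms(4) by (intro integrable_const_bound[of _ B]) auto
qed

lemma char_conv_imp_trig_polynomial_conv:
  fixes \<mu> :: "nat \<Rightarrow> 'a::euclidean_space measure"
  assumes \<mu>: "\<And>n. prob_space (\<mu> n)" "\<And>n. sets (\<mu> n) = sets borel"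
    and \<nu>: "prob_space \<nu>" "sets \<nu> = sets borel"
    and conv: "\<And>t. (\<lambda>n. CLINT x|\<mu> n. iexp (t \<bullet> x)) \<longlonglongrightarrow> (CLINT x|\<nu>. iexp (t \<bullet> x))"
    and f: "trig_polynomial f"
  shows "(\<lambda>n. CLINT x|\<mu> n. f x) \<longlonglongrightarrow> (CLINT x|\<nu>. f x)"
  using f
proof (induction f)
  case (add f g)
  have int: "integrable \<rho> f" "integrable \<rho> g" if "prob_space \<rho>" "sets \<rho> = sets borel" for \<rho>
    using trig_polynomial_bounded_continuous add.hyps integrable_bounded_continuous[OF that]
    by blast+
  show ?case
    using tendsto_add[OF add.IH] int \<mu> \<nu> by simp
qed (simp_all add: conv tendsto_mult_left)

text \<open>
  The coordinates \<open>sin (x\<^sub>b / L)\<close> are trigonometric polynomials, and these form an algebra; hence every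
  polynomial in such coordinates is one. The sines compress the whole space into a cube, which makes
  polynomial approximation bounded everywhere.
\<close>
lemma real_polynomial_sin_trig:
  fixes L :: real
  assumes "real_polynomial_function (p :: 'a::euclidean_space \<Rightarrow> real)"
  shows "trig_polynomial (\<lambda>x. of_real (p (\<Sum>b\<in>Basis. sin (x \<bullet> b / L) *\<^sub>R b)))"
  using assms
proof (induction p)
  case (linear h)
  then interpret bounded_linear h .
  have "trig_polynomial (\<lambda>x. \<Sum>b\<in>Basis. of_real (h b) * of_real (sin ((b /\<^sub>R L) \<bullet> x)))"
    by (intro trig_polynomial_sum trig_polynomial.scale trig_polynomial_sin) simp
  moreover have "(\<Sum>b\<in>Basis. of_real (h b) * of_real (sin ((b /\<^sub>R L) \<bullet> x)))
     = complex_of_real (h (\<Sum>b\<in>Basis. sin (x \<bullet> b / L) *\<^sub>R b))" for x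
    by (simp add: sum scale mult.commute inner_commute divide_inverse)
  ultimately show ?case by simp
next
  case (mult f g)
  then show ?case
    using trig_polynomial_mult by fastforce
next
  case (add f g)
  then show ?case
    using trig_polynomial.add by fastforce
qed (rule trig_polynomial_const)

text \<open>
  A continuous majorant of the indicator of \<open>\<bar>y\<bar> \<ge> R + 1\<close>, so that weak convergence applies to it.
\<close>
definition tail_weight :: "real \<Rightarrow> real \<Rightarrow> real" where
  "tail_weight R y = min 1 (max 0 (\<bar>y\<bar> - R))"

lemma tail_weight_bounds: "0 \<le> tail_weight R y" "tail_weight R y \<le> 1"
  by (auto simp: tail_weight_def)

lemma tail_weight_eq_1: "\<bar>y\<bar> \<ge> R + 1 \<Longrightarrow> tail_weight R y = 1"
  by (auto simp: tail_weight_def)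

lemma continuous_tail_weight: "continuous_on S (tail_weight R)"
  unfolding tail_weight_def by (intro continuous_intros)

text \<open>
  The one-dimensional continuity theorem, applied to the coordinate \<open>b\<close>, whose characteristic function is
  that of the vector along the line spanned by \<open>b\<close>. Together with the next lemma it is the tightness of the
  sequence.
\<close>
lemma marginal_tail_conv:
  fixes \<mu> :: "nat \<Rightarrow> 'a::euclidean_space measure"
  assumes \<mu>: "\<And>n. prob_space (\<mu> n)" "\<And>n. sets (\<mu> n) = sets borel"
    and \<nu>: "prob_space \<nu>" "sets \<nu> = sets borel"
    and conv: "\<And>t. (\<lambda>n. CLINT x|\<mu> n. iexp (t \<bullet> x)) \<longlonglongrightarrow> (CLINT x|\<nu>. iexp (t \<bullet> x))"
  shows "(\<lambda>n. \<integral>x. tail_weight R (x \<bullet> b) \<partial>\<mu> n) \<longlonglongrightarrow> (\<integral>x. tail_weight R (x \<bullet> b) \<partial>\<nu>)"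
proof -
  define D where "D \<rho> = distr \<rho> borel (\<lambda>x::'a. x \<bullet> b)" for \<rho>
  have meas: "(\<lambda>x::'a. x \<bullet> b) \<in> borel_measurable \<rho>" if "sets \<rho> = sets borel" for \<rho>
    using that by (simp cong: measurable_cong_sets)
  have D: "real_distribution (D \<rho>)" if "prob_space \<rho>" "sets \<rho> = sets borel" for \<rho>
    using that prob_space.prob_space_distr[OF that(1) meas[OF that(2)]]
    by (simp add: real_distribution_def real_distribution_axioms_def D_def)
  have char: "char (D \<rho>) t = (CLINT x|\<rho>. iexp ((t *\<^sub>R b) \<bullet> x))" if "sets \<rho> = sets borel" for \<rho> t
    unfolding char_def D_def using meas[OF that]
    by (subst integral_distr) (auto simp: inner_commute)
  have "weak_conv_m (\<lambda>n. D (\<mu> n)) (D \<nu>)"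
    by (rule levy_continuity) (simp_all add: D \<mu> \<nu> char conv del: inner_scaleR_left)
  then have "(\<lambda>n. integral\<^sup>L (D (\<mu> n)) (tail_weight R)) \<longlonglongrightarrow> integral\<^sup>L (D \<nu>) (tail_weight R)"
    by (rule weak_conv_imp_integral_bdd_continuous_conv[where B = 1, rotated 2])
       (use continuous_tail_weight[of UNIV] tail_weight_bounds in
         \<open>simp_all add: D \<mu> \<nu> continuous_on_eq_continuous_at\<close>)
  moreover have "integral\<^sup>L (D \<rho>) (tail_weight R) = (\<integral>x. tail_weight R (x \<bullet> b) \<partial>\<rho>)"
    if "sets \<rho> = sets borel" for \<rho>
    unfolding D_def using meas[OF that] borel_measurable_continuous_onI[OF continuous_tail_weight]
    by (subst integral_distr) auto
  ultimately show ?thesis using \<mu> \<nu> by simp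
qed

lemma marginal_tail_vanishes:
  fixes \<nu> :: "'a::euclidean_space measure"
  assumes \<nu>: "prob_space \<nu>" "sets \<nu> = sets borel"
  shows "(\<lambda>k. \<integral>x. tail_weight (real k) (x \<bullet> b) \<partial>\<nu>) \<longlonglongrightarrow> 0"
proof -
  interpret prob_space \<nu> by fact
  have "(\<lambda>k. \<integral>x. tail_weight (real k) (x \<bullet> b) \<partial>\<nu>) \<longlonglongrightarrow> (\<integral>x. 0 \<partial>\<nu>)"
  proof (rule integral_dominated_convergence[where w = "\<lambda>_. 1"])
    show "AE x in \<nu>. (\<lambda>k. tail_weight (real k) (x \<bullet> b)) \<longlonglongrightarrow> 0"
    proof (rule AE_I2)
      fix x
      have "\<forall>\<^sub>F k in sequentially. tail_weight (real k) (x \<bullet> b) = 0"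
        using eventually_ge_at_top[of "nat \<lceil>\<bar>x \<bullet> b\<bar>\<rceil>"]
        by eventually_elim (simp add: tail_weight_def nat_le_iff le_nat_iff, linarith)
      then show "(\<lambda>k. tail_weight (real k) (x \<bullet> b)) \<longlonglongrightarrow> 0"
        by (rule tendsto_eventually)
    qed
    show "(\<lambda>x. tail_weight (real k) (x \<bullet> b)) \<in> borel_measurable \<nu>" for k
      using \<nu>(2) unfolding tail_weight_def by (simp cong: measurable_cong_sets)
  qed (use tail_weight_bounds in auto)
  then show ?thesis by simp
qed

text \<open>
  On the box \<open>\<bar>x\<^sub>b\<bar> \<le> R + 1\<close> the map \<open>x \<mapsto> sin (x / L)\<close> is inverted by the arcsine, so \<open>f\<close> is there a continuous
  function \<open>G\<close> of the sines. Since \<open>G\<close> lives on the compact cube and inherits the bound of \<open>f\<close>, a polynomial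
  close to \<open>G\<close> on the cube is close to \<open>f\<close> on the box and bounded by \<open>B + e\<close> everywhere; outside the box
  the tail weights pay for the error.
\<close>
lemma trig_polynomial_approximation:
  fixes f :: "'a::euclidean_space \<Rightarrow> real"
  assumes f: "continuous_on UNIV f" "\<And>x. \<bar>f x\<bar> \<le> B" and "e > 0" "R \<ge> 0"
  obtains p where "trig_polynomial (\<lambda>x. of_real (p x))" "continuous_on UNIV p" "\<And>x. \<bar>p x\<bar> \<le> B + e"
    "\<And>x. \<bar>f x - p x\<bar> \<le> e + (2 * B + e) * (\<Sum>b\<in>Basis. tail_weight R (x \<bullet> b))"
proof -
  \<comment> \<open>On the box, \<open>\<bar>x\<^sub>b / L\<bar> \<le> 1 < \<pi>/2\<close>, where the arcsine inverts the sine.\<close>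
  define L where "L = R + 1"
  have L: "L > 0" using assms by (simp add: L_def)
  define S where "S x = (\<Sum>b\<in>Basis. sin (x \<bullet> b / L) *\<^sub>R b)" for x :: 'a
  define G where "G s = f (\<Sum>b\<in>Basis. (L * arcsin (s \<bullet> b)) *\<^sub>R b)" for s :: 'a
  have S_cube: "S x \<in> cbox (- One) One" for x
    by (simp add: S_def mem_box)
  have "continuous_on (cbox (- One) One) (\<lambda>s::'a. \<Sum>b\<in>Basis. (L * arcsin (s \<bullet> b)) *\<^sub>R b)"
    by (intro continuous_intros) (auto simp: mem_box)
  then have "continuous_on (cbox (- One) One) G"
    unfolding G_def by (rule continuous_on_compose2[OF f(1)]) auto
  then obtain q where q: "real_polynomial_function q"
      "\<And>s. s \<in> cbox (- One) One \<Longrightarrow> \<bar>G s - q s\<bar> < e"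
    using Stone_Weierstrass_real_polynomial_function[of "cbox (- One) One" G e] \<open>e > 0\<close> by auto
  define p where "p x = q (S x)" for x
  have trig: "trig_polynomial (\<lambda>x. of_real (p x))"
    unfolding p_def S_def by (rule real_polynomial_sin_trig[OF q(1)])
  have bound: "\<bar>p x\<bar> \<le> B + e" for x
    using q(2)[OF S_cube[of x]] f(2)[of "\<Sum>b\<in>Basis. (L * arcsin (S x \<bullet> b)) *\<^sub>R b"]
    unfolding p_def G_def by linarith
  have "B \<ge> 0" using f(2)[of 0] by linarith
  have approx: "\<bar>f x - p x\<bar> \<le> e + (2 * B + e) * (\<Sum>b\<in>Basis. tail_weight R (x \<bullet> b))" (is "_ \<le> ?rhs") for x
  proof (cases "\<forall>b\<in>Basis. \<bar>x \<bullet> b\<bar> \<le> L")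
    case True
    have "L * arcsin (S x \<bullet> b) = x \<bullet> b" if b: "b \<in> Basis" for b
    proof -
      have "\<bar>x \<bullet> b / L\<bar> \<le> 1" using True b L by (simp add: abs_divide)
      then have "- (pi / 2) \<le> x \<bullet> b / L" "x \<bullet> b / L \<le> pi / 2" using pi_gt3 by linarith+
      then show ?thesis using L b by (simp add: S_def arcsin_sin)
    qed
    then have "(\<Sum>b\<in>Basis. (L * arcsin (S x \<bullet> b)) *\<^sub>R b) = (\<Sum>b\<in>Basis. (x \<bullet> b) *\<^sub>R b)"
      by (intro sum.cong) auto
    then have "G (S x) = f x"
      by (simp add: G_def euclidean_representation)
    then have "\<bar>f x - p x\<bar> \<le> e"
      using q(2)[OF S_cube[of x]] by (simp add: p_def)
    moreover have "0 \<le> (2 * B + e) * (\<Sum>b\<in>Basis. tail_weight R (x \<bullet> b))"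
      using \<open>B \<ge> 0\<close> \<open>e > 0\<close> by (intro mult_nonneg_nonneg sum_nonneg tail_weight_bounds) auto
    ultimately show ?thesis by linarith
  next
    case False
    then obtain b where b: "b \<in> Basis" "\<bar>x \<bullet> b\<bar> > L" by force
    have "1 = tail_weight R (x \<bullet> b)" using b by (simp add: tail_weight_eq_1 L_def)
    also have "\<dots> \<le> (\<Sum>b\<in>Basis. tail_weight R (x \<bullet> b))"
      using b by (intro member_le_sum) (auto simp: tail_weight_bounds)
    finally have "2 * B + e \<le> (2 * B + e) * (\<Sum>b\<in>Basis. tail_weight R (x \<bullet> b))"
      using \<open>B \<ge> 0\<close> \<open>e > 0\<close> by (simp add: mult_le_cancel_left1)
    then show ?thesis
      using f(2)[of x] bound[of x] \<open>e > 0\<close> by linarith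
  qed
  have "continuous_on UNIV p"
  proof -
    have "continuous_on UNIV (\<lambda>x. Re (of_real (p x)))"
      using trig_polynomial_bounded_continuous[OF trig] by (intro continuous_intros) auto
    then show ?thesis by simp
  qed
  with that trig bound approx show ?thesis by blast
qed

text \<open>
  The integral of \<open>f\<close> is replaced by that of the approximating trigonometric polynomial. The price is
  bounded by the mean tail weights, which converge along the sequence and are small in the limit for a
  large box.
\<close>
theorem levy_continuity_euclidean:
  fixes \<mu> :: "nat \<Rightarrow> 'a::euclidean_space measure"
  assumes \<mu>: "\<And>n. prob_space (\<mu> n)" "\<And>n. sets (\<mu> n) = sets borel"
    and \<nu>: "prob_space \<nu>" "sets \<nu> = sets borel"
    and conv: "\<And>t. (\<lambda>n. CLINT x|\<mu> n. iexp (t \<bullet> x)) \<longlonglongrightarrow> (CLINT x|\<nu>. iexp (t \<bullet> x))"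
  shows "weakly_converges \<mu> \<nu>"
  unfolding weakly_converges_def
proof (intro allI impI LIMSEQ_I)
  fix f :: "'a \<Rightarrow> real" and r :: real
  assume "continuous_on UNIV f \<and> bounded (range f)" and "0 < r"
  then obtain B where f: "continuous_on UNIV f" "\<And>x. \<bar>f x\<bar> \<le> B"
    unfolding bounded_iff by auto
  have "B \<ge> 0" using f(2)[of 0] by linarith
  \<comment> \<open>Four errors of at most \<open>e\<close> for the two replacements, and one for the trigonometric polynomial.\<close>
  define e where "e = r / 5"
  have "e > 0" using \<open>r > 0\<close> by (simp add: e_def)
  define H where "H R x = (\<Sum>b\<in>Basis. tail_weight R (x \<bullet> b))" for R and x :: 'a
  have int_tail: "integrable \<rho> (\<lambda>x. tail_weight R (x \<bullet> b))"
    if "prob_space \<rho>" "sets \<rho> = sets borel" for \<rho> R and b :: 'a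
    by (rule integrable_bounded_continuous[OF that, where B = 1])
       (auto intro!: continuous_on_compose2[OF continuous_tail_weight] continuous_intros
             simp: abs_of_nonneg tail_weight_bounds)
  have int_H: "integrable \<rho> (H R)" if "prob_space \<rho>" "sets \<rho> = sets borel" for \<rho> R
    unfolding H_def using int_tail[OF that] by simp
  have "(\<lambda>k. (2 * B + e) * (\<integral>x. H (real k) x \<partial>\<nu>)) \<longlonglongrightarrow> (2 * B + e) * (\<Sum>b\<in>(Basis :: 'a set). 0)"
    unfolding H_def using int_tail[OF \<nu>]
    by (simp only: Bochner_Integration.integral_sum)
       (intro tendsto_mult_left tendsto_sum marginal_tail_vanishes[OF \<nu>])
  then have "\<forall>\<^sub>F k in sequentially. (2 * B + e) * (\<integral>x. H (real k) x \<partial>\<nu>) < e"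
    using \<open>e > 0\<close> by (auto dest: order_tendstoD(2)[of _ _ _ e])
  then obtain k where k: "(2 * B + e) * (\<integral>x. H (real k) x \<partial>\<nu>) < e"
    by (auto simp: eventually_sequentially)
  obtain p where p: "trig_polynomial (\<lambda>x. of_real (p x))" "continuous_on UNIV p" "\<And>x. \<bar>p x\<bar> \<le> B + e"
    "\<And>x. \<bar>f x - p x\<bar> \<le> e + (2 * B + e) * H (real k) x"
    using trig_polynomial_approximation[OF f \<open>e > 0\<close>, of "real k"] unfolding H_def by auto
  have diff: "\<bar>(\<integral>x. f x \<partial>\<rho>) - (\<integral>x. p x \<partial>\<rho>)\<bar> \<le> e + (2 * B + e) * (\<integral>x. H (real k) x \<partial>\<rho>)"
    if "prob_space \<rho>" "sets \<rho> = sets borel" for \<rho>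
  proof -
    interpret prob_space \<rho> by fact
    have int: "integrable \<rho> f" "integrable \<rho> p"
      using integrable_bounded_continuous[OF that] f p by (metis real_norm_def)+
    have "\<bar>(\<integral>x. f x \<partial>\<rho>) - (\<integral>x. p x \<partial>\<rho>)\<bar> = \<bar>\<integral>x. f x - p x \<partial>\<rho>\<bar>"
      using int by simp
    also have "\<dots> \<le> (\<integral>x. \<bar>f x - p x\<bar> \<partial>\<rho>)"
      by (rule integral_abs_bound)
    also have "\<dots> \<le> (\<integral>x. e + (2 * B + e) * H (real k) x \<partial>\<rho>)"
      using int int_H[OF that] p(4) by (intro integral_mono) auto
    also have "\<dots> = e + (2 * B + e) * (\<integral>x. H (real k) x \<partial>\<rho>)"
      using int_H[OF that] by (simp add: prob_space)
    finally show ?thesis .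
  qed
  have "(\<lambda>n. \<integral>x. p x \<partial>\<mu> n) \<longlonglongrightarrow> (\<integral>x. p x \<partial>\<nu>)"
    using char_conv_imp_trig_polynomial_conv[OF \<mu> \<nu> conv p(1)] 
    by (simp add: tendsto_of_real_iff)
  moreover have "(\<lambda>n. (2 * B + e) * (\<integral>x. H (real k) x \<partial>\<mu> n)) \<longlonglongrightarrow> (2 * B + e) * (\<integral>x. H (real k) x \<partial>\<nu>)"
    unfolding H_def using int_tail \<mu> \<nu>
    by (simp only: Bochner_Integration.integral_sum)
       (intro tendsto_mult_left tendsto_sum marginal_tail_conv[OF \<mu> \<nu> conv])
  ultimately have "\<forall>\<^sub>F n in sequentially. \<bar>(\<integral>x. p x \<partial>\<mu> n) - (\<integral>x. p x \<partial>\<nu>)\<bar> < e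
      \<and> (2 * B + e) * (\<integral>x. H (real k) x \<partial>\<mu> n) < e"
    using \<open>e > 0\<close> k
    by (intro eventually_conj) (auto dest: tendstoD simp: dist_real_def intro: order_tendstoD(2))
  then have "\<forall>\<^sub>F n in sequentially. \<bar>(\<integral>x. f x \<partial>\<mu> n) - (\<integral>x. f x \<partial>\<nu>)\<bar> < r"
  proof eventually_elim
    case (elim n)
    then show ?case
      using diff[OF \<mu>(1,2), of n] diff[OF \<nu>] k unfolding e_def by linarith
  qed
  then show "\<exists>N. \<forall>n\<ge>N. norm ((\<integral>x. f x \<partial>\<mu> n) - (\<integral>x. f x \<partial>\<nu>)) < r"
    by (simp add: eventually_sequentially)
qed

section \<open>Cycle counts of permutations\<close>

text \<open>
  Composing \<open>p\<close> with the transposition of a new point \<open>a\<close> and \<open>b\<close> splices \<open>a\<close> into the cycle of \<open>b\<close>, just before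
  \<open>b\<close>. All other cycles stay as they are.
\<close>
lemma orbit_insert_point:
  fixes p :: "'a \<Rightarrow> 'a"
  assumes fin: "finite S" and p: "p permutes S" and a: "a \<notin> S" and b: "b \<in> S"
  defines "q \<equiv> Transposition.transpose a b \<circ> p"
  shows "x \<in> S \<Longrightarrow> orbit q x = orbit p x \<union> (if b \<in> orbit p x then {a} else {})"
    and "orbit q a = orbit q b"
proof -
  have pa: "p a = a" using p a by (simp add: permutes_not_in)
  have qa: "q a = b" by (simp add: q_def pa)
  have qb: "p y = b \<Longrightarrow> q y = a" for y by (simp add: q_def)
  have qo: "y \<in> S \<Longrightarrow> p y \<noteq> b \<Longrightarrow> q y = p y" for y
    using a permutes_in_image[OF p, of y] by (auto simp: q_def Transposition.transpose_def)
  show *: "orbit q x = orbit p x \<union> (if b \<in> orbit p x then {a} else {})" if x: "x \<in> S" for x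
  proof
    have sub: "y \<in> S" if "y \<in> orbit p x" for y
      using permutes_orbit_subset[OF p x] that by blast
    show "orbit q x \<subseteq> orbit p x \<union> (if b \<in> orbit p x then {a} else {})"
    proof
      fix y assume "y \<in> orbit q x"
      then show "y \<in> orbit p x \<union> (if b \<in> orbit p x then {a} else {})"
      proof induction
        case base
        show ?case
          using orbit.base[of p x] qb[of x] qo[OF x] by (cases "p x = b") auto
      next
        case (step y)
        show ?case
        proof (cases "y = a")
          case True
          then show ?thesis using step sub a by (auto simp: qa split: if_splits)
        next
          case False
          then have "y \<in> orbit p x" using step by (auto split: if_splits)
          then show ?thesis using orbit.step[of y p x] sub qb[of y] qo[of y]
            by (cases "p y = b") auto
        qed
      qed
    qed
    have *: "p y \<in> orbit q x \<and> (p y = b \<longrightarrow> a \<in> orbit q x)"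
      if y: "y \<in> S" "y = x \<or> y \<in> orbit q x" for y
    proof (cases "p y = b")
      case True
      then have "a \<in> orbit q x" using y qb[OF True] orbit.base[of q x] orbit.step[of y q x] by auto
      then show ?thesis using orbit.step[of a q x] True by (simp add: qa)
    next
      case False
      then show ?thesis using y qo[of y] orbit.base[of q x] orbit.step[of y q x] by auto
    qed
    have "y \<in> orbit q x \<and> (y = b \<longrightarrow> a \<in> orbit q x)" if "y \<in> orbit p x" for y
      using that
    proof induction
      case base
      show ?case using *[OF x] by auto
    next
      case (step y)
      then show ?case using *[of y] sub by blast
    qed
    then show "orbit p x \<union> (if b \<in> orbit p x then {a} else {}) \<subseteq> orbit q x"
      by auto
  qed
  show "orbit q a = orbit q b"
  proof
    show "orbit q b \<subseteq> orbit q a"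
      using orbit.base[of q a] unfolding qa by (blast intro: orbit_trans)
    have "a \<in> orbit q b"
    proof -
      have "b \<in> orbit p b"
        using permutes_imp_permutation[OF fin p] by (rule permutation_self_in_orbit)
      then show ?thesis using *[OF b] by simp
    qed
    then show "orbit q a \<subseteq> orbit q b"
      by (blast intro: orbit_trans)
  qed
qed

lemma cycles_empty [simp]: "cycles 0 p = {}"
  by (simp add: cycles_def)

lemma finite_cycles [simp]: "finite (cycles n p)"
  by (simp add: cycles_def)

lemma num_cycles_Suc_fixed:
  assumes p: "p permutes {1..n}"
  shows "num_cycles (Suc n) p = Suc (num_cycles n p)"
proof -
  have fixed: "p (Suc n) = Suc n" using p by (simp add: permutes_not_in)
  then have orb: "orbit p (Suc n) = {Suc n}"
    by (simp add: orbit_eq_singleton_iff)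
  have "{Suc n} \<notin> cycles n p"
    using permutes_orbit_subset[OF p] by (fastforce simp: cycles_def)
  moreover have "cycles (Suc n) p = insert {Suc n} (cycles n p)"
    by (simp add: cycles_def atLeastAtMostSuc_conv orb)
  ultimately show ?thesis by (simp add: num_cycles_def)
qed

text \<open>
  Splicing a point into an existing cycle sets up a bijection between the old and the new cycles.
\<close>
lemma num_cycles_Suc_inserted:
  assumes p: "p permutes {1..n}" and b: "b \<in> {1..n}"
  shows "num_cycles (Suc n) (Transposition.transpose (Suc n) b \<circ> p) = num_cycles n p"
proof -
  define q where "q = Transposition.transpose (Suc n) b \<circ> p"
  define G where "G c = c \<union> (if b \<in> c then {Suc n} else {})" for c
  note ins = orbit_insert_point[OF _ p _ b, where a = "Suc n", folded q_def]
  have "cycles (Suc n) q = orbit q ` {1..n}"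
    using ins(2) b by (auto simp: cycles_def atLeastAtMostSuc_conv)
  also have "\<dots> = G ` cycles n p"
    unfolding cycles_def image_image using ins(1) by (intro image_cong) (auto simp: G_def)
  finally have "cycles (Suc n) q = G ` cycles n p" .
  moreover have "inj_on G (cycles n p)"
  proof (rule inj_onI)
    fix c d assume cd: "c \<in> cycles n p" "d \<in> cycles n p" "G c = G d"
    have "c - {Suc n} = c" if "c \<in> cycles n p" for c
      using that permutes_orbit_subset[OF p] by (fastforce simp: cycles_def)
    moreover have "G c - {Suc n} = c - {Suc n}" for c by (auto simp: G_def)
    ultimately show "c = d" using cd by metis
  qed
  ultimately show ?thesis by (simp add: num_cycles_def card_image q_def)
qed

text \<open>
  A permutation of \<open>n + 1\<close> points arises from exactly one permutation of \<open>n\<close> points, either by adding a fixed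
  point (a new cycle, factor \<open>u\<close>) or by splicing the new point in front of one of the \<open>n\<close> old ones
  (factor \<open>1\<close> each). This is the recursion of the rising factorial.
\<close>
theorem sum_permutations_power_num_cycles:
  fixes u :: "'a::comm_ring_1"
  shows "(\<Sum>p\<in>S_n n. u ^ num_cycles n p) = pochhammer u n"
proof (induction n)
  case 0
  then show ?case by (simp add: num_cycles_def)
next
  case (Suc n)
  define F where "F = (\<lambda>(b, p). Transposition.transpose (Suc n) b \<circ> p :: nat \<Rightarrow> nat)"
  have S: "{1..Suc n} = insert (Suc n) {1..n}" by auto
  have img: "S_n (Suc n) = F ` ({1..Suc n} \<times> S_n n)"
    unfolding S permutes_insert F_def by (rule arg_cong[where f = "image _"]) auto
  have inj: "inj_on F ({1..Suc n} \<times> S_n n)"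
  proof (rule inj_onI, clarify)
    fix b p c q
    assume p: "p permutes {1..n}" and q: "q permutes {1..n}" and eq: "F (b, p) = F (c, q)"
    have "p (Suc n) = Suc n" "q (Suc n) = Suc n" using p q by (simp_all add: permutes_not_in)
    with eq have bc: "b = c"
      unfolding F_def by (metis case_prod_conv comp_apply transpose_apply_first)
    with eq have "Transposition.transpose (Suc n) b \<circ> (Transposition.transpose (Suc n) b \<circ> p) = Transposition.transpose (Suc n) b \<circ> (Transposition.transpose (Suc n) b \<circ> q)"
      by (simp add: F_def)
    then have "p = q" by (simp add: o_assoc)
    with bc show "b = c \<and> p = q" by simp
  qed
  have "(\<Sum>p\<in>S_n (Suc n). u ^ num_cycles (Suc n) p)
     = (\<Sum>b\<in>{1..Suc n}. \<Sum>p\<in>S_n n. u ^ num_cycles (Suc n) (F (b, p)))"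
    unfolding img by (subst sum.reindex[OF inj]) (simp add: sum.cartesian_product o_def)
  also have "\<dots> = (\<Sum>p\<in>S_n n. u ^ num_cycles (Suc n) (F (Suc n, p)))
      + (\<Sum>b\<in>{1..n}. \<Sum>p\<in>S_n n. u ^ num_cycles (Suc n) (F (b, p)))"
    by (simp add: S)
  also have "(\<Sum>p\<in>S_n n. u ^ num_cycles (Suc n) (F (Suc n, p))) = u * pochhammer u n"
    unfolding Suc[symmetric] sum_distrib_left
    by (intro sum.cong) (simp_all add: F_def num_cycles_Suc_fixed)
  also have "(\<Sum>b\<in>{1..n}. \<Sum>p\<in>S_n n. u ^ num_cycles (Suc n) (F (b, p)))
      = (\<Sum>b\<in>{1..n}. pochhammer u n)"
    unfolding Suc[symmetric] by (intro sum.cong) (simp_all add: F_def num_cycles_Suc_inserted)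
  finally show ?case by (simp add: pochhammer_Suc algebra_simps)
qed

lemma sum_num_cycles_of_length:
  assumes p: "p permutes {1..n}"
  shows "(\<Sum>m=1..n. num_cycles_of_length n p m) = num_cycles n p"
proof -
  have "card c \<in> {1..n}" if c: "c \<in> cycles n p" for c
  proof -
    obtain x where x: "x \<in> {1..n}" "c = orbit p x" using c unfolding cycles_def by blast
    have "c \<subseteq> {1..n}" using x permutes_orbit_subset[OF p] by simp
    moreover have "c \<noteq> {}" using x by (auto simp: orbit_nonempty)
    ultimately show ?thesis
      using card_mono[of "{1..n}" c] by (auto simp: Suc_le_eq card_gt_0_iff finite_subset)
  qed
  then have "cycles n p = (\<Union>m\<in>{1..n}. {c \<in> cycles n p. card c = m})" by auto
  then have "num_cycles n p = card (\<Union>m\<in>{1..n}. {c \<in> cycles n p. card c = m})"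
    by (simp add: num_cycles_def)
  also have "\<dots> = (\<Sum>m\<in>{1..n}. card {c \<in> cycles n p. card c = m})"
    by (rule card_UN_disjoint) auto
  finally show ?thesis by (simp add: num_cycles_of_length_def)
qed

section \<open>The logarithm of one minus a uniform point of the circle\<close>

lemma prob_space_unit_interval: "prob_space (uniform_measure lborel {0..1::real})"
  by (rule prob_space_uniform_measure) simp_all

lemma prob_space_uniform_circle: "prob_space uniform_circle"
  unfolding uniform_circle_def
  by (rule prob_space.prob_space_distr[OF prob_space_unit_interval]) (simp add: cis_conv_exp)

lemma sets_uniform_circle [simp, measurable_cong]: "sets uniform_circle = sets borel"
  by (simp add: uniform_circle_def)

lemma space_uniform_circle [simp]: "space uniform_circle = UNIV"
  by (simp add: uniform_circle_def)

lemma measurable_cis [measurable]: "cis \<in> borel_measurable borel"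
  by (intro borel_measurable_continuous_onI continuous_intros)

lemma unit_interval_density:
  "uniform_measure lborel {0..1::real} = density lborel (\<lambda>t. ennreal (indicator {0..1} t))"
  by (simp add: uniform_measure_def divide_ennreal_def ennreal_indicator)

lemma integral_uniform_circle:
  fixes f :: "complex \<Rightarrow> 'b::{banach, second_countable_topology}"
  assumes [measurable]: "f \<in> borel_measurable borel"
  shows "(\<integral>w. f w \<partial>uniform_circle) = (\<integral>t\<in>{0..1}. f (cis (2 * pi * t)) \<partial>lborel)"
  unfolding uniform_circle_def unit_interval_density set_lebesgue_integral_def
  by (subst integral_distr, simp, simp) (subst integral_density, auto)

lemma integrable_uniform_circle:
  fixes f :: "complex \<Rightarrow> 'b::{banach, second_countable_topology}"
  assumes [measurable]: "f \<in> borel_measurable borel"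
  shows "integrable uniform_circle f \<longleftrightarrow> set_integrable lborel {0..1} (\<lambda>t. f (cis (2 * pi * t)))"
  unfolding uniform_circle_def unit_interval_density set_integrable_def
  by (subst integrable_distr_eq, simp, simp) (subst integrable_density, auto)

lemma AE_uniform_circle:
  assumes "AE t in lborel. t \<in> {0<..<1} \<longrightarrow> P (cis (2 * pi * t))" "Measurable.pred borel P"
  shows "AE w in uniform_circle. P w"
proof -
  have "AE t in lborel. t \<noteq> 0 \<and> t \<noteq> (1::real)"
    using AE_lborel_singleton[of 0] AE_lborel_singleton[of 1] by eventually_elim simp
  with assms(1) have "AE t in lborel. t \<in> {0..1} \<longrightarrow> P (cis (2 * pi * t))"
    by eventually_elim auto
  then show ?thesis
    using assms(2) unfolding uniform_circle_def unit_interval_density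
    by (subst AE_distr_iff) (auto simp: AE_density indicator_def)
qed

text \<open>
  In the angle the rotation is a translation by \<open>s\<close>; the piece pushed beyond \<open>1\<close> returns at \<open>0\<close> by
  periodicity.
\<close>
lemma integral_uniform_circle_rotate:
  fixes f :: "complex \<Rightarrow> complex"
  assumes [measurable]: "f \<in> borel_measurable borel" and B: "\<And>w. norm (f w) \<le> B" and c: "norm c = 1"
  shows "(\<integral>w. f (c * w) \<partial>uniform_circle) = (\<integral>w. f w \<partial>uniform_circle)"
proof -
  \<comment> \<open>The angle of \<open>c\<close>, measured in full turns.\<close>
  define s where "s = Arg2pi c / (2 * pi)"
  have s: "0 \<le> s" "s < 1"
    using Arg2pi[of c] by (simp_all add: s_def)
  have cs: "c = cis (2 * pi * s)"
    using Arg2pi_eq[of c] c by (simp add: s_def cis_conv_exp)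
  define g where "g t = f (cis (2 * pi * t))" for t :: real
  have [measurable]: "g \<in> borel_measurable borel" unfolding g_def by simp
  have int: "set_integrable lborel {a..b} g" for a b
    unfolding set_integrable_def
    by (rule integrableI_bounded_set_indicator[where B = B]) (auto simp: g_def B emeasure_lborel_Icc_eq)
  have rot: "f (c * cis (2 * pi * t)) = g (s + t)" for t
    unfolding cs g_def by (simp add: cis_mult distrib_left)
  have per: "g (t + 1) = g t" for t
    by (simp add: g_def distrib_left flip: cis_mult)
  have shift: "(\<integral>t\<in>{a..b}. g (d + t) \<partial>lborel) = (\<integral>t\<in>{a + d..b + d}. g t \<partial>lborel)" for a b d
    unfolding set_lebesgue_integral_def
    by (subst lborel_integral_real_affine[of 1 _ d]) (auto intro!: Bochner_Integration.integral_cong simp: indicator_def)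
  have split: "(\<integral>t\<in>{a..b}. g t \<partial>lborel) + (\<integral>t\<in>{b..d}. g t \<partial>lborel) = (\<integral>t\<in>{a..d}. g t \<partial>lborel)"
    if "a \<le> b" "b \<le> d" for a b d
  proof -
    have *: "(\<integral>t\<in>{u..v}. g t \<partial>lborel) = (LBINT t=ereal u..ereal v. g t)" if "u \<le> v" for u v
      using that by (simp add: interval_integral_Icc)
    show ?thesis using that
      by (simp add: *) (subst interval_integral_sum, auto simp: min_def max_def interval_lebesgue_integrable_def
        intro!: set_integrable_subset[OF int[of a d]])
  qed
  have "(\<integral>w. f (c * w) \<partial>uniform_circle) = (\<integral>t\<in>{0..1}. g (s + t) \<partial>lborel)"
    by (subst integral_uniform_circle) (simp_all add: rot)
  also have "\<dots> = (\<integral>t\<in>{s..1 + s}. g t \<partial>lborel)"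
    by (simp add: shift)
  also have "\<dots> = (\<integral>t\<in>{s..1}. g t \<partial>lborel) + (\<integral>t\<in>{1..1 + s}. g t \<partial>lborel)"
    using s by (simp add: split)
  also have "(\<integral>t\<in>{1..1 + s}. g t \<partial>lborel) = (\<integral>t\<in>{0..s}. g t \<partial>lborel)"
    using shift[of 0 s 1] per by (simp add: add.commute)
  also have "(\<integral>t\<in>{s..1}. g t \<partial>lborel) + (\<integral>t\<in>{0..s}. g t \<partial>lborel) = (\<integral>t\<in>{0..1}. g t \<partial>lborel)"
    using split[of 0 s 1] s by (simp add: add.commute)
  finally show ?thesis
    by (subst (2) integral_uniform_circle) (simp_all add: g_def)
qed

lemma Ln_one_minus_cis:
  assumes t: "0 < t" "t < 1"
  shows "Ln (1 - cis (2 * pi * t)) = of_real (ln (2 * sin (pi * t))) + \<i> * of_real (pi * (t - 1 / 2))"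
proof -
  have sin: "sin (pi * t) > 0" using t by (intro sin_gt_zero) auto
  have "1 - cis (2 * pi * t) = of_real (2 * sin (pi * t)) * cis (pi * (t - 1 / 2))"
  proof (rule complex_eqI)
    have "cos (pi * t - pi / 2) = sin (pi * t)" "sin (pi * t - pi / 2) = - cos (pi * t)"
      by (simp_all add: cos_diff sin_diff)
    moreover have "cos (2 * (pi * t)) = 1 - 2 * (sin (pi * t))\<^sup>2" "sin (2 * (pi * t)) = 2 * sin (pi * t) * cos (pi * t)"
      by (rule cos_double_sin, rule sin_double)
    ultimately show "Re (1 - cis (2 * pi * t)) = Re (of_real (2 * sin (pi * t)) * cis (pi * (t - 1 / 2)))"
      "Im (1 - cis (2 * pi * t)) = Im (of_real (2 * sin (pi * t)) * cis (pi * (t - 1 / 2)))"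
      by (simp_all add: algebra_simps power2_eq_square)
  qed
  also have "\<dots> = exp (of_real (ln (2 * sin (pi * t))) + \<i> * of_real (pi * (t - 1 / 2)))"
    using sin by (simp add: exp_add cis_conv_exp exp_of_real)
  also have "Ln \<dots> = of_real (ln (2 * sin (pi * t))) + \<i> * of_real (pi * (t - 1 / 2))"
  proof (rule Ln_exp)
    have "pi * (t - 1/2) < pi * 1" "pi * (-1) < pi * (t - 1/2)"
      using t by (intro mult_strict_left_mono; simp)+
    then show "- pi < Im (of_real (ln (2 * sin (pi * t))) + \<i> * of_real (pi * (t - 1 / 2)))"
      "Im (of_real (ln (2 * sin (pi * t))) + \<i> * of_real (pi * (t - 1 / 2))) \<le> pi"
      by simp_all
  qed
  finally show ?thesis .
qed


text \<open>
  Cauchy's integral formula at the centre, written in the angle.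
\<close>
lemma circle_mean_value:
  fixes f :: "complex \<Rightarrow> complex"
  assumes f: "f holomorphic_on ball 0 1" and r: "0 < r" "r < 1"
    and [measurable]: "f \<in> borel_measurable borel"
  shows "(\<integral>w. f (of_real r * w) \<partial>uniform_circle) = f 0"
proof -
  define g where "g t = f (of_real r * cis (2 * pi * t))" for t :: real
  have hol: "f holomorphic_on cball 0 r"
    using r by (intro holomorphic_on_subset[OF f]) auto
  have "((\<lambda>u. f u / u) has_contour_integral 2 * of_real pi * \<i> * f 0) (circlepath 0 r)"
    using Cauchy_integral_circlepath_simple[OF hol, of 0] r by simp
  then have "((\<lambda>t. f (circlepath 0 r t) / circlepath 0 r t * vector_derivative (circlepath 0 r) (at t))
      has_integral 2 * of_real pi * \<i> * f 0) {0..1}"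
    unfolding has_contour_integral .
  moreover have "f (circlepath 0 r t) / circlepath 0 r t * vector_derivative (circlepath 0 r) (at t)
      = (2 * of_real pi * \<i>) * g t" for t
  proof -
    have "circlepath 0 r t = of_real r * cis (2 * pi * t)"
      by (simp add: circlepath cis_conv_exp mult_ac)
    moreover have "vector_derivative (circlepath 0 r) (at t) = 2 * of_real pi * \<i> * (of_real r * cis (2 * pi * t))"
      by (simp add: vector_derivative_circlepath cis_conv_exp mult_ac)
    ultimately show ?thesis using r by (simp add: g_def)
  qed
  ultimately have "((\<lambda>t. (2 * of_real pi * \<i>) * g t) has_integral (2 * of_real pi * \<i>) * f 0) {0..1}"
    by simp
  from has_integral_mult_right[OF this, of "inverse (2 * of_real pi * \<i>)"]
  have "(g has_integral f 0) {0..1}"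
  proof -
    have cancel: "inverse (2 * of_real pi * \<i>) * ((2 * of_real pi * \<i>) * z) = z" for z
      by (subst mult.assoc[symmetric], subst left_inverse) auto
    assume "((\<lambda>t. inverse (2 * of_real pi * \<i>) * ((2 * of_real pi * \<i>) * g t)) has_integral
      inverse (2 * of_real pi * \<i>) * ((2 * of_real pi * \<i>) * f 0)) {0..1}"
    then show ?thesis unfolding cancel .
  qed
  moreover have "continuous_on {0..1} g"
    unfolding g_def using r
    by (intro continuous_on_compose2[OF holomorphic_on_imp_continuous_on[OF hol]] continuous_intros)
       (auto simp: norm_mult)
  then have "set_integrable lborel {0..1} g"
    unfolding set_integrable_def by (intro borel_integrable_compact) auto
  ultimately have "(\<integral>t\<in>{0..1}. g t \<partial>lborel) = f 0"
    using set_borel_integral_eq_integral(2) by (metis integral_unique)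
  then show ?thesis
    by (subst integral_uniform_circle) (simp_all add: g_def)
qed

lemma AE_uniform_circle_generic: "AE w in uniform_circle. norm w = 1 \<and> w \<noteq> 1"
proof (rule AE_uniform_circle)
  have "cis (2 * pi * t) \<noteq> 1" if "0 < t" "t < 1" for t
  proof
    assume "cis (2 * pi * t) = 1"
    moreover have "sin (pi * t) > 0" using that by (intro sin_gt_zero) auto
    ultimately show False
      using cos_double_sin[of "pi * t"] by (simp add: complex_eq_iff mult_ac)
  qed
  then show "AE t in lborel. t \<in> {0<..<1} \<longrightarrow> norm (cis (2 * pi * t)) = 1 \<and> cis (2 * pi * t) \<noteq> 1"
    by auto
qed simp

lemma integrable_inverse_sqrt_unit: "set_integrable lborel {0..1} (\<lambda>t::real. t powr (- 1 / 2))"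
proof -
  have "(\<lambda>t::real. t powr (- 1 / 2)) absolutely_integrable_on {0..1}"
    by (intro nonnegative_absolutely_integrable_1 integrable_on_powr_from_0) auto
  then show ?thesis
    unfolding set_integrable_def by (subst (asm) integrable_completion) simp_all
qed

lemma norm_one_minus_cis: "0 \<le> t \<Longrightarrow> t \<le> 1 \<Longrightarrow> norm (1 - cis (2 * pi * t)) = 2 * sin (pi * t)"
proof -
  assume t: "0 \<le> t" "t \<le> 1"
  have "(norm (1 - cis (2 * pi * t)))\<^sup>2 = (1 - cos (2 * (pi * t)))\<^sup>2 + (sin (2 * (pi * t)))\<^sup>2"
    by (simp add: cmod_power2 mult.assoc)
  also have "\<dots> = 2 - 2 * cos (2 * (pi * t))"
    using sin_cos_squared_add[of "2 * (pi * t)"] by (simp add: power2_eq_square algebra_simps)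
  also have "\<dots> = (2 * sin (pi * t))\<^sup>2"
    by (simp add: cos_double_sin power2_eq_square)
  finally show ?thesis
    using t by (subst (asm) power2_eq_iff_nonneg) (auto intro!: sin_ge_zero simp: mult_left_le)
qed

lemma sin_pi_ge_min:
  assumes "0 \<le> t" "t \<le> 1"
  shows "min t (1 - t) \<le> sin (pi * t)"
proof -
  have half: "t \<le> sin (pi * t)" if "0 \<le> t" "t \<le> 1 / 2" for t
  proof -
    \<comment> \<open>The cubic Taylor bound suffices on \<open>[0, \<pi>/2]\<close>, where \<open>x \<le> 8/5\<close>.\<close>
    define x where "x = pi * t"
    have "x \<le> pi * (1 / 2)" unfolding x_def using that by (intro mult_left_mono) auto
    moreover have "pi \<le> 16 / 5" using pi_approx(2) by simp
    ultimately have "x \<le> 8 / 5" by linarith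
    moreover have "0 \<le> x" using that by (simp add: x_def)
    moreover note x = calculation
    have "\<bar>sin x - x\<bar> \<le> x ^ 3 / 6"
      using Maclaurin_sin_bound[of x 3] x by (simp add: sin_coeff_def numeral_3_eq_3 fact_numeral)
    moreover have "x ^ 3 \<le> x * (8 / 5) ^ 2"
      unfolding power3_eq_cube power2_eq_square mult.assoc using x by (intro mult_mono) auto
    ultimately have "x - x * (8 / 5) ^ 2 / 6 \<le> sin x"
      by linarith
    then have "x / 2 \<le> sin x"
      using x(2) by (simp add: power2_eq_square)
    moreover have "t \<le> x / 2" using that pi_gt3 mult_right_mono[of 2 pi t] unfolding x_def by simp
    ultimately show ?thesis by (simp add: x_def)
  qed
  show ?thesis
  proof (cases "t \<le> 1 / 2")
    case True
    then show ?thesis using half[of t] assms by simp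
  next
    case False
    have "sin (pi * (1 - t)) = sin (pi * t)" by (simp add: right_diff_distrib)
    then show ?thesis using half[of "1 - t"] assms False by simp
  qed
qed

text \<open>
  This supplies the dominating function for the passage to the unit circle: \<open>\<bar>1 - w\<bar>\<close> is at least
  proportional to the distance of the angle to the endpoints, whose inverse square root is integrable.
\<close>
lemma integrable_inverse_sqrt_distance:
  "integrable uniform_circle (\<lambda>w. (norm (1 - w) / 2) powr (- 1 / 2))"
proof -
  have "set_integrable lborel {0..1} (\<lambda>t::real. (1 - t) powr (- 1 / 2))"
    using integrable_inverse_sqrt_unit
    unfolding set_integrable_def
    by (subst (asm) lborel_integrable_real_affine_iff[of "-1" _ 1, symmetric])
       (auto simp: indicator_def elim!: back_subst[of "integrable lborel"])
  then have "set_integrable lborel {0..1} (\<lambda>t::real. t powr (- 1 / 2) + (1 - t) powr (- 1 / 2))"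
    using integrable_inverse_sqrt_unit by (intro set_integral_add)
  then have "set_integrable lborel {0..1} (\<lambda>t. (norm (1 - cis (2 * pi * t)) / 2) powr (- 1 / 2))"
  proof (rule set_integrable_bound)
    have "norm ((norm (1 - cis (2 * pi * t)) / 2) powr (- 1 / 2)) \<le> norm (t powr (- 1 / 2) + (1 - t) powr (- 1 / 2))"
      if t: "t \<in> {0..1}" "t \<noteq> 0" "t \<noteq> 1" for t
    proof -
      have "(sin (pi * t)) powr (- 1 / 2) \<le> (min t (1 - t)) powr (- 1 / 2)"
        using sin_pi_ge_min[of t] t by (intro powr_mono2') auto
      also have "\<dots> \<le> t powr (- 1 / 2) + (1 - t) powr (- 1 / 2)"
        by (simp add: min_def)
      finally show ?thesis using t by (simp add: norm_one_minus_cis)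
    qed
    moreover have "AE t in lborel. t \<noteq> 0 \<and> t \<noteq> (1::real)"
      using AE_lborel_singleton[of 0] AE_lborel_singleton[of 1] by eventually_elim simp
    ultimately show "AE t in lborel. t \<in> {0..1} \<longrightarrow>
        norm ((norm (1 - cis (2 * pi * t)) / 2) powr (- 1 / 2)) \<le> norm (t powr (- 1 / 2) + (1 - t) powr (- 1 / 2))"
      by (auto elim: eventually_mono)
  qed (simp add: set_borel_measurable_def)
  then show ?thesis
    by (subst integrable_uniform_circle) auto
qed

text \<open>
  The bound is uniform in \<open>r\<close> because \<open>\<bar>1 - r w\<bar> \<ge> \<bar>1 - w\<bar> / 2\<close>, so the only singularity is the
  logarithmic one at \<open>w = 1\<close>. The logarithm is estimated by the power \<open>-1/4\<close>, so that its square is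
  dominated by an integrable power.
\<close>
lemma Ln_one_minus_bound:
  assumes w: "norm w = 1" "w \<noteq> 1" and r: "1 / 2 \<le> r" "r \<le> 1"
  shows "(norm (Ln (1 - of_real r * w)))\<^sup>2 \<le> 50 + 32 * (norm (1 - w) / 2) powr (- 1 / 2)"
proof -
  define q where "q = norm (1 - w) / 2"
  have "norm (1 - w) \<le> 2" using norm_triangle_ineq4[of 1 w] w by simp
  then have q: "0 < q" "q \<le> 1" using w by (simp_all add: q_def)
  have rw: "norm (of_real r * w) = r" using w r by (simp add: norm_mult)
  have up: "norm (1 - of_real r * w) \<le> 2"
    using norm_triangle_ineq4[of 1 "of_real r * w"] r unfolding rw by simp
  have low: "q \<le> norm (1 - of_real r * w)"
  proof -
    have "norm (1 - w) \<le> norm (1 - of_real r * w) + norm (of_real r * w - w)"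
      by (rule norm_diff_triangle_ineq[of 1 "of_real r * w" "of_real r * w" w, simplified])
    also have "norm (of_real r * w - w) = 1 - r"
    proof -
      have "of_real r * w - w = of_real (r - 1) * w" by (simp add: algebra_simps)
      then show ?thesis using w r by (simp add: norm_mult del: of_real_diff)
    qed
    also have "1 - r \<le> norm (1 - of_real r * w)"
      using norm_triangle_ineq2[of 1 "of_real r * w"] unfolding rw by simp
    finally show ?thesis by (simp add: q_def)
  qed
  have nz: "1 - of_real r * w \<noteq> 0" using low q by auto
  have "\<bar>ln (norm (1 - of_real r * w))\<bar> \<le> ln 2 - ln q"
    using ln_mono[of q "norm (1 - of_real r * w)"] ln_mono[of "norm (1 - of_real r * w)" 2] q low up nz
      ln_le_zero_iff[of q] ln_ge_zero[of 2] by (simp add: abs_le_iff; linarith)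
  moreover have "norm (Ln (1 - of_real r * w)) \<le> \<bar>Re (Ln (1 - of_real r * w))\<bar> + \<bar>Im (Ln (1 - of_real r * w))\<bar>"
    by (rule cmod_le)
  moreover have "\<bar>Im (Ln (1 - of_real r * w))\<bar> \<le> pi"
    using Im_Ln_le_pi[OF nz] mpi_less_Im_Ln[OF nz] by simp
  \<comment> \<open>The constant comes from \<open>ln 2 + \<pi> < 5\<close>.\<close>
  ultimately have "norm (Ln (1 - of_real r * w)) \<le> 5 - ln q"
    using nz ln_2_less_1 pi_less_4 by simp
  moreover have "- ln q \<le> 4 * q powr (- 1 / 4)"
    using ln_le_minus_one[of "q powr (- 1 / 4)"] q by (simp add: ln_powr)
  ultimately have "norm (Ln (1 - of_real r * w)) \<le> 5 + 4 * q powr (- 1 / 4)" by simp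
  then have "(norm (Ln (1 - of_real r * w)))\<^sup>2 \<le> (5 + 4 * q powr (- 1 / 4))\<^sup>2"
    by (intro power_mono) auto
  also have "\<dots> \<le> 2 * 5\<^sup>2 + 2 * (4 * q powr (- 1 / 4))\<^sup>2"
    using sum_squares_bound[of 5 "4 * q powr (- 1 / 4)"] unfolding power2_sum by linarith
  also have "\<dots> = 50 + 32 * q powr (- 1 / 2)"
    by (simp add: power2_eq_square flip: powr_add)
  finally show ?thesis by (simp add: q_def)
qed

text \<open>
  The mean value property holds on circles of radius \<open>r < 1\<close> and gives \<open>Ln (1 - 0) ^ p = 0\<close>; dominated
  convergence carries it to the unit circle.
\<close>
lemma Ln_power_integral_zero:
  assumes p: "p = 1 \<or> p = (2::nat)"
  shows "integrable uniform_circle (\<lambda>w. Ln (1 - w) ^ p)"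
    and "(\<integral>w. Ln (1 - w) ^ p \<partial>uniform_circle) = 0"
proof -
  interpret prob_space uniform_circle by (rule prob_space_uniform_circle)
  define D where "D w = 51 + 32 * (norm (1 - w) / 2) powr (- 1 / 2)" for w :: complex
  \<comment> \<open>Radii increasing to \<open>1\<close>, at least \<open>1/2\<close> as the uniform bound demands.\<close>
  define r where "r n = 1 - 1 / real (n + 2)" for n
  have r: "1 / 2 \<le> r n" "r n < 1" for n by (simp_all add: r_def field_simps)
  have D: "integrable uniform_circle D"
    unfolding D_def using integrable_inverse_sqrt_distance by simp
  have bound: "norm (Ln (1 - of_real c * w) ^ p) \<le> D w" if "norm w = 1" "w \<noteq> 1" "1 / 2 \<le> c" "c \<le> 1" for w c
  proof -
    have "norm z ^ p \<le> 1 + norm z ^ 2" for z :: complex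
      using p sum_squares_bound[of 1 "norm z"] zero_le_power2[of "norm z"] norm_ge_zero[of z]
      by (auto simp: power2_eq_square intro: order_trans[of _ "2 * norm z"])
    from this[of "Ln (1 - of_real c * w)"] show ?thesis
      using Ln_one_minus_bound[OF that] unfolding D_def norm_power by linarith
  qed
  have meas: "(\<lambda>w. Ln (1 - c * w) ^ p) \<in> borel_measurable uniform_circle" for c
    by (simp cong: measurable_cong_sets)
  have lim: "AE w in uniform_circle. (\<lambda>n. Ln (1 - of_real (r n) * w) ^ p) \<longlonglongrightarrow> Ln (1 - w) ^ p"
    using AE_uniform_circle_generic
  proof eventually_elim
    case (elim w)
    have "1 - w \<notin> \<real>\<^sub>\<le>\<^sub>0"
    proof
      assume "1 - w \<in> \<real>\<^sub>\<le>\<^sub>0"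
      then have "Re w \<ge> 1" "Im w = 0" by (auto simp: complex_nonpos_Reals_iff)
      then show False using elim by (auto simp: cmod_def complex_eq_iff)
    qed
    moreover have "r \<longlonglongrightarrow> 1" unfolding r_def by real_asymp
    then have "(\<lambda>n. 1 - of_real (r n) * w) \<longlonglongrightarrow> 1 - of_real 1 * w"
      by (intro tendsto_intros)
    ultimately show ?case
      by (intro tendsto_power tendsto_Ln) simp_all
  qed
  have dom: "AE w in uniform_circle. norm (Ln (1 - of_real (r n) * w) ^ p) \<le> D w" for n
    using AE_uniform_circle_generic
    by eventually_elim (intro bound; use r[of n] in simp)
  note conv = integral_dominated_convergence[OF _ meas D lim dom]
  show "integrable uniform_circle (\<lambda>w. Ln (1 - w) ^ p)"
    by (rule integrable_dominated_convergence[OF _ meas D lim dom]) (use meas[of 1] in simp)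
  have "(\<lambda>n. \<integral>w. Ln (1 - of_real (r n) * w) ^ p \<partial>uniform_circle) \<longlonglongrightarrow> (\<integral>w. Ln (1 - w) ^ p \<partial>uniform_circle)"
    by (rule conv) (use meas[of 1] in simp)
  moreover have "(\<integral>w. Ln (1 - of_real (r n) * w) ^ p \<partial>uniform_circle) = 0" for n
  proof -
    have "(\<lambda>z. Ln (1 - z) ^ p) holomorphic_on ball 0 1"
    proof (intro holomorphic_intros)
      fix z :: complex assume "z \<in> ball 0 1"
      then show "1 - z \<notin> \<real>\<^sub>\<le>\<^sub>0"
        using complex_Re_le_cmod[of z] by (auto simp: complex_nonpos_Reals_iff)
    qed
    then have "(\<integral>w. Ln (1 - of_real (r n) * w) ^ p \<partial>uniform_circle) = Ln (1 - 0) ^ p"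
      using r[of n] by (intro circle_mean_value) auto
    then show ?thesis using p by auto
  qed
  ultimately show "(\<integral>w. Ln (1 - w) ^ p \<partial>uniform_circle) = 0"
    by (simp add: LIMSEQ_const_iff)
qed

text \<open>
  The imaginary part is \<open>\<pi> (t - 1/2)\<close> at the angle \<open>2 \<pi> t\<close>.
\<close>
lemma Im_Ln_second_moment:
  "integrable uniform_circle (\<lambda>w. (Im (Ln (1 - w)))\<^sup>2)"
  "(\<integral>w. (Im (Ln (1 - w)))\<^sup>2 \<partial>uniform_circle) = pi\<^sup>2 / 12"
proof -
  interpret prob_space uniform_circle by (rule prob_space_uniform_circle)
  have "AE w in uniform_circle. norm ((Im (Ln (1 - w)))\<^sup>2) \<le> pi\<^sup>2"
    using AE_uniform_circle_generic
  proof eventually_elim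
    case (elim w)
    then have "\<bar>Im (Ln (1 - w))\<bar> \<le> pi"
      using Im_Ln_le_pi[of "1 - w"] mpi_less_Im_Ln[of "1 - w"] by simp
    then show ?case by (simp add: abs_le_square_iff[symmetric])
  qed
  then show "integrable uniform_circle (\<lambda>w. (Im (Ln (1 - w)))\<^sup>2)"
    by (rule integrable_const_bound) (simp cong: measurable_cong_sets)
  have "(\<integral>w. (Im (Ln (1 - w)))\<^sup>2 \<partial>uniform_circle) = (\<integral>t\<in>{0..1}. (Im (Ln (1 - cis (2 * pi * t))))\<^sup>2 \<partial>lborel)"
    by (rule integral_uniform_circle) simp
  also have "\<dots> = (\<integral>t. (pi * (t - 1 / 2))\<^sup>2 * indicator {0..1} t \<partial>lborel)"
    unfolding set_lebesgue_integral_def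
  proof (rule integral_cong_AE)
    have "AE t in lborel. t \<noteq> 0 \<and> t \<noteq> (1::real)"
      using AE_lborel_singleton[of 0] AE_lborel_singleton[of 1] by eventually_elim simp
    then show "AE t in lborel. indicat_real {0..1} t *\<^sub>R (Im (Ln (1 - cis (2 * pi * t))))\<^sup>2
        = (pi * (t - 1 / 2))\<^sup>2 * indicator {0..1} t"
      by eventually_elim (auto simp: indicator_def Ln_one_minus_cis)
  qed simp_all
  also have "\<dots> = pi\<^sup>2 * (1 - 1 / 2) ^ 3 / 3 - pi\<^sup>2 * (0 - 1 / 2) ^ 3 / 3"
    by (rule integral_FTC_Icc_real[where F = "\<lambda>t. pi\<^sup>2 * (t - 1 / 2) ^ 3 / 3"])
       (auto intro!: derivative_eq_intros continuous_intros simp: power_mult_distrib)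
  also have "\<dots> = pi\<^sup>2 / 12" by (simp add: field_simps power3_eq_cube)
  finally show "(\<integral>w. (Im (Ln (1 - w)))\<^sup>2 \<partial>uniform_circle) = pi\<^sup>2 / 12" .
qed

text \<open>
  The mean of \<open>Ln (1 - U)\<^sup>2\<close> vanishes, so that the quadratic form \<open>(c \<bullet> L)\<^sup>2\<close> has the same mean as
  \<open>\<bar>c\<bar>\<^sup>2 (Im L)\<^sup>2\<close>: the two differ by the real part of a multiple of \<open>L\<^sup>2\<close>. In particular the covariance is a
  multiple of the identity.
\<close>
lemma Ln_projection_moments:
  fixes c :: complex
  shows "integrable uniform_circle (\<lambda>w. c \<bullet> Ln (1 - w))"
    and "(\<integral>w. c \<bullet> Ln (1 - w) \<partial>uniform_circle) = 0"
    and "integrable uniform_circle (\<lambda>w. (c \<bullet> Ln (1 - w))\<^sup>2)"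
    and "(\<integral>w. (c \<bullet> Ln (1 - w))\<^sup>2 \<partial>uniform_circle) = (norm c)\<^sup>2 * (pi\<^sup>2 / 12)"
proof -
  note L1 = Ln_power_integral_zero[of 1, simplified]
  note L2 = Ln_power_integral_zero[of 2, simplified]
  show "integrable uniform_circle (\<lambda>w. c \<bullet> Ln (1 - w))" "(\<integral>w. c \<bullet> Ln (1 - w) \<partial>uniform_circle) = 0"
    using L1 by simp_all
  \<comment> \<open>The last term has mean \<open>0\<close> at \<open>z = Ln (1 - U)\<close>, being the real part of a multiple of \<open>z\<^sup>2\<close>.\<close>
  have eq: "(c \<bullet> z)\<^sup>2 = (norm c)\<^sup>2 * (Im z)\<^sup>2 + Re ((of_real ((norm c)\<^sup>2) + (cnj c)\<^sup>2) * z\<^sup>2) / 2" for z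
  proof -
    have "Re ((of_real N + (cnj c)\<^sup>2) * z\<^sup>2)
        = (N + (Re c)\<^sup>2 - (Im c)\<^sup>2) * ((Re z)\<^sup>2 - (Im z)\<^sup>2) + 4 * Re c * Im c * Re z * Im z" for N
      by (simp add: power2_eq_square algebra_simps)
    then show ?thesis
      unfolding cmod_power2 inner_complex_def
      by (simp only:) (simp add: power2_eq_square add_divide_distrib diff_divide_distrib algebra_simps)
  qed
  define k where "k = of_real ((norm c)\<^sup>2) + (cnj c)\<^sup>2"
  have int: "integrable uniform_circle (\<lambda>w. Re (k * (Ln (1 - w))\<^sup>2) / 2)"
    using L2(1) by (intro integrable_divide integrable_Re integrable_mult_right) simp
  have zero: "(\<integral>w. Re (k * (Ln (1 - w))\<^sup>2) / 2 \<partial>uniform_circle) = 0"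
    using L2 by simp
  show "integrable uniform_circle (\<lambda>w. (c \<bullet> Ln (1 - w))\<^sup>2)"
    unfolding eq k_def[symmetric] using int Im_Ln_second_moment(1) by simp
  show "(\<integral>w. (c \<bullet> Ln (1 - w))\<^sup>2 \<partial>uniform_circle) = (norm c)\<^sup>2 * (pi\<^sup>2 / 12)"
    unfolding eq k_def[symmetric] using int zero Im_Ln_second_moment
    by (subst Bochner_Integration.integral_add) auto
qed

section \<open>Ratios of rising factorials\<close>

text \<open>
  Both bounds telescope, as \<open>1 / (y + 1) \<le> ln (y + 1) - ln y \<le> 1 / y\<close>.
\<close>
lemma sum_shifted_reciprocals_asymp:
  fixes \<theta> :: real
  assumes "\<theta> > 0"
  shows "(\<lambda>n. (\<Sum>k<n. \<theta> / (\<theta> + real k)) / ln (real n)) \<longlonglongrightarrow> \<theta>"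
proof -
  have "(\<lambda>n. (\<Sum>k<n. 1 / (\<theta> + real k)) / ln (real n)) \<longlonglongrightarrow> 1"
  proof (rule tendsto_sandwich)
    have low: "ln (\<theta> + real n) - ln \<theta> \<le> (\<Sum>k<n. 1 / (\<theta> + real k))" for n
    proof (induction n)
      case (Suc n)
      have "ln (\<theta> + real (Suc n)) - ln (\<theta> + real n) \<le> 1 / (\<theta> + real n)"
        using assms ln_diff_le[of "\<theta> + real (Suc n)" "\<theta> + real n"] by simp
      then show ?case using Suc by simp
    qed simp
    have "(\<Sum>k<Suc n. 1 / (\<theta> + real k)) \<le> 1 / \<theta> + (ln (\<theta> + real n) - ln \<theta>)" for n
    proof (induction n)
      case (Suc n)
      have "1 / (\<theta> + real (Suc n)) \<le> ln (\<theta> + real (Suc n)) - ln (\<theta> + real n)"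
        using assms ln_diff_le[of "\<theta> + real n" "\<theta> + real (Suc n)"] by simp
      then show ?case using Suc by simp
    qed simp
    then have high: "(\<Sum>k<n. 1 / (\<theta> + real k)) \<le> 1 / \<theta> + (ln (\<theta> + real n) - ln \<theta>)" for n
    proof (rule order_trans[rotated])
      show "(\<Sum>k<n. 1 / (\<theta> + real k)) \<le> (\<Sum>k<Suc n. 1 / (\<theta> + real k))"
        using assms by simp
    qed
    show "\<forall>\<^sub>F n in sequentially. (ln (\<theta> + real n) - ln \<theta>) / ln (real n) \<le> (\<Sum>k<n. 1 / (\<theta> + real k)) / ln (real n)"
      using eventually_ge_at_top[of 2] by eventually_elim (use low in \<open>auto intro!: divide_right_mono\<close>)
    show "\<forall>\<^sub>F n in sequentially. (\<Sum>k<n. 1 / (\<theta> + real k)) / ln (real n) \<le> (1 / \<theta> + (ln (\<theta> + real n) - ln \<theta>)) / ln (real n)"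
      using eventually_ge_at_top[of 2] by eventually_elim (use high in \<open>auto intro!: divide_right_mono\<close>)
    show "(\<lambda>n. (ln (\<theta> + real n) - ln \<theta>) / ln (real n)) \<longlonglongrightarrow> 1"
      using assms by real_asymp
    show "(\<lambda>n. (1 / \<theta> + (ln (\<theta> + real n) - ln \<theta>)) / ln (real n)) \<longlonglongrightarrow> 1"
      using assms by real_asymp
  qed
  from tendsto_mult_left[OF this, of \<theta>] show ?thesis
    by (simp add: sum_distrib_left)
qed

text \<open>
  The ratio is the product of \<open>1 + w\<^sub>k\<close> with \<open>w\<^sub>k = \<theta> (u - 1) / (\<theta> + k)\<close>. The sum of the \<open>w\<^sub>k\<close> tends to \<open>\<theta> l\<close>, since the
  harmonic weights add up to \<open>\<theta> ln n\<close> asymptotically. Replacing \<open>1 + w\<^sub>k\<close> by \<open>exp w\<^sub>k\<close> costs at most the sum of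
  \<open>\<bar>w\<^sub>k\<bar>\<^sup>2\<close>, which is of order \<open>1 / ln n\<close>: all factors lie in the unit disc because \<open>\<bar>u\<bar> \<le> 1\<close>, so the errors
  just add up.
\<close>
lemma pochhammer_ratio_limit:
  fixes \<theta> :: real and u :: "nat \<Rightarrow> complex"
  assumes \<theta>: "\<theta> > 0" and u: "\<And>n. norm (u n) \<le> 1"
    and lim: "(\<lambda>n. of_real (ln (real n)) * (u n - 1)) \<longlonglongrightarrow> l"
  shows "(\<lambda>n. pochhammer (of_real \<theta> * u n) n / of_real (pochhammer \<theta> n)) \<longlonglongrightarrow> exp (of_real \<theta> * l)"
proof -
  define r where "r k = \<theta> / (\<theta> + real k)" for k
  define h where "h n = (\<Sum>k<n. r k)" for n
  have r: "0 \<le> r k" "r k \<le> 1" for k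
    using \<theta> by (simp_all add: r_def)
  define w where "w n k = of_real (r k) * (u n - 1)" for n k
  have ratio: "pochhammer (of_real \<theta> * u n) n / of_real (pochhammer \<theta> n) = (\<Prod>k<n. 1 + w n k)" for n
  proof -
    have "(of_real \<theta> * u n + of_nat k) / of_real (\<theta> + real k) = 1 + w n k" for k
    proof -
      have "complex_of_real \<theta> + of_nat k \<noteq> 0"
        using \<theta> by (metis add_pos_nonneg less_irrefl of_nat_0_le_iff of_real_add of_real_eq_0_iff of_real_of_nat_eq)
      then show ?thesis by (simp add: w_def r_def field_simps)
    qed
    then have "(\<Prod>k<n. 1 + w n k) = (\<Prod>k<n. of_real \<theta> * u n + of_nat k) / (\<Prod>k<n. of_real (\<theta> + real k))"
      by (simp only: prod_dividef[symmetric])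
    then show ?thesis
      unfolding pochhammer_prod atLeast0LessThan by (simp only: of_real_prod of_real_of_nat_eq)
  qed
  have norm_w: "norm (1 + w n k) \<le> 1" for n k
  proof -
    have "1 + w n k = of_real (1 - r k) + of_real (r k) * u n"
      by (simp add: w_def algebra_simps)
    also have "norm \<dots> \<le> (1 - r k) + r k * norm (u n)"
      using r[of k] by (intro norm_triangle_le) (simp add: norm_mult flip: of_real_diff)
    also have "\<dots> \<le> 1" using r[of k] u[of n] by (simp add: mult_left_le)
    finally show ?thesis .
  qed
  have norm_exp_w: "norm (exp (w n k)) \<le> 1" for n k
  proof -
    have "Re (u n) \<le> 1" using u[of n] complex_Re_le_cmod order_trans by blast
    then show ?thesis using r[of k] by (simp add: w_def mult_nonneg_nonpos)
  qed
  have taylor: "norm ((1 + w n k) - exp (w n k)) \<le> exp 2 * (norm (u n - 1))\<^sup>2 * r k" for n k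
  proof -
    have small: "norm (w n k) \<le> 2"
    proof -
      have "norm (w n k) \<le> 1 * 2"
        unfolding w_def norm_mult using r[of k] u[of n] norm_triangle_ineq4[of "u n" 1]
        by (intro mult_mono) auto
      then show ?thesis by simp
    qed
    have "norm ((1 + w n k) - exp (w n k)) \<le> exp \<bar>Re (w n k)\<bar> * norm (w n k) ^ 2"
      using Taylor_exp[of "w n k" 1] by (simp add: norm_minus_commute numeral_2_eq_2)
    also have "\<dots> \<le> exp 2 * norm (w n k) ^ 2"
      using small abs_Re_le_cmod[of "w n k"] by (intro mult_right_mono) auto
    also have "norm (w n k) ^ 2 = (norm (u n - 1))\<^sup>2 * (r k * r k)"
      using r[of k] by (simp add: w_def norm_mult power2_eq_square)
    also have "\<dots> \<le> (norm (u n - 1))\<^sup>2 * r k"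
      using r[of k] by (intro mult_left_mono mult_left_le) auto
    finally show ?thesis by (simp add: mult.assoc)
  qed
  have h_lim: "(\<lambda>n. h n / ln (real n)) \<longlonglongrightarrow> \<theta>"
    using sum_shifted_reciprocals_asymp[OF \<theta>] by (simp add: h_def r_def)
  have "(\<lambda>n. (\<Prod>k<n. exp (w n k))) \<longlonglongrightarrow> exp (of_real \<theta> * l)"
  proof -
    have "(\<lambda>n. of_real (h n / ln (real n)) * (of_real (ln (real n)) * (u n - 1))) \<longlonglongrightarrow> of_real \<theta> * l"
      by (intro tendsto_intros h_lim lim)
    moreover have "\<forall>\<^sub>F n in sequentially. of_real (h n / ln (real n)) * (of_real (ln (real n)) * (u n - 1))
        = (\<Sum>k<n. w n k)"
      using eventually_ge_at_top[of 2]
    proof eventually_elim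
      case (elim n)
      have "(\<Sum>k<n. w n k) = of_real (h n) * (u n - 1)"
        by (simp add: h_def w_def sum_distrib_right)
      then show ?case using elim by simp
    qed
    ultimately have "(\<lambda>n. \<Sum>k<n. w n k) \<longlonglongrightarrow> of_real \<theta> * l"
      by (rule Lim_transform_eventually)
    then show ?thesis
      by (simp add: exp_sum[symmetric] tendsto_exp)
  qed
  moreover have "(\<lambda>n. (\<Prod>k<n. 1 + w n k) - (\<Prod>k<n. exp (w n k))) \<longlonglongrightarrow> 0"
  proof (rule Lim_null_comparison)
    show "\<forall>\<^sub>F n in sequentially. norm ((\<Prod>k<n. 1 + w n k) - (\<Prod>k<n. exp (w n k)))
        \<le> exp 2 * (norm (of_real (ln (real n)) * (u n - 1)))\<^sup>2 * (h n / ln (real n)) * (1 / ln (real n))"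
      using eventually_ge_at_top[of 2]
    proof eventually_elim
      case (elim n)
      have "norm ((\<Prod>k<n. 1 + w n k) - (\<Prod>k<n. exp (w n k))) \<le> (\<Sum>k<n. norm ((1 + w n k) - exp (w n k)))"
        using norm_w norm_exp_w by (intro norm_prod_diff) auto
      also have "\<dots> \<le> (\<Sum>k<n. exp 2 * (norm (u n - 1))\<^sup>2 * r k)"
        by (intro sum_mono taylor)
      also have "\<dots> = exp 2 * (norm (u n - 1))\<^sup>2 * h n"
        by (simp add: h_def sum_distrib_left)
      also have "\<dots> = exp 2 * (norm (of_real (ln (real n)) * (u n - 1)))\<^sup>2 * (h n / ln (real n)) * (1 / ln (real n))"
      proof -
        have "norm (of_real (ln (real n)) * (u n - 1)) = ln (real n) * norm (u n - 1)"
          using elim by (simp add: norm_mult)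
        then show ?thesis using elim by (simp add: power2_eq_square)
      qed
      finally show ?case .
    qed
    have "(\<lambda>n. 1 / ln (real n)) \<longlonglongrightarrow> 0" by real_asymp
    then have "(\<lambda>n. exp 2 * (norm (of_real (ln (real n)) * (u n - 1)))\<^sup>2 * (h n / ln (real n)) * (1 / ln (real n)))
        \<longlonglongrightarrow> exp 2 * (norm l)\<^sup>2 * \<theta> * 0"
      by (intro tendsto_intros h_lim lim)
    then show "(\<lambda>n. exp 2 * (norm (of_real (ln (real n)) * (u n - 1)))\<^sup>2 * (h n / ln (real n)) * (1 / ln (real n)))
        \<longlonglongrightarrow> 0" by simp
  qed
  ultimately have "(\<lambda>n. (\<Prod>k<n. 1 + w n k)) \<longlonglongrightarrow> exp (of_real \<theta> * l)"
    by (rule Lim_transform)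
  then show ?thesis by (simp add: ratio)
qed

section \<open>Second-order expansion of characteristic functions\<close>

lemma iexp_second_order_pointwise:
  fixes x :: real
  shows "((\<lambda>s. (iexp (s * x) - 1 - \<i> * of_real (s * x)) / of_real (s\<^sup>2)) \<longlongrightarrow> of_real (- (x\<^sup>2) / 2)) (at 0)"
proof -
  have "((\<lambda>s. (iexp (s * x) - 1 - \<i> * of_real (s * x)) / of_real (s\<^sup>2) - of_real (- (x\<^sup>2) / 2)) \<longlongrightarrow> 0) (at 0)"
  proof (rule Lim_null_comparison)
    show "\<forall>\<^sub>F s in at 0. norm ((iexp (s * x) - 1 - \<i> * of_real (s * x)) / of_real (s\<^sup>2) - of_real (- (x\<^sup>2) / 2)) \<le> \<bar>s\<bar> * \<bar>x\<bar> ^ 3 / 6"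
      unfolding eventually_at_filter
    proof (intro always_eventually allI impI)
      fix s :: real assume s: "s \<noteq> 0"
      have "(iexp (s * x) - 1 - \<i> * of_real (s * x)) / of_real (s\<^sup>2) - of_real (- (x\<^sup>2) / 2)
          = (iexp (s * x) - (\<Sum>k\<le>2. (\<i> * of_real (s * x)) ^ k / fact k)) / of_real (s\<^sup>2)"
        using s by (simp add: numeral_2_eq_2 field_simps power2_eq_square)
      also have "norm \<dots> \<le> (\<bar>s * x\<bar> ^ 3 / 6) / s\<^sup>2"
        unfolding norm_divide norm_of_real abs_power2
      proof (rule divide_right_mono)
        show "norm (iexp (s * x) - (\<Sum>k\<le>2. (\<i> * of_real (s * x)) ^ k / fact k)) \<le> \<bar>s * x\<bar> ^ 3 / 6"
          using iexp_approx1[of "s * x" 2] by (simp add: eval_nat_numeral)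
      qed simp
      also have "\<dots> = \<bar>s\<bar> * \<bar>x\<bar> ^ 3 / 6"
        using s by (simp add: abs_mult power_mult_distrib power3_eq_cube power2_eq_square field_simps abs_mult_self_eq)
      finally show "norm ((iexp (s * x) - 1 - \<i> * of_real (s * x)) / of_real (s\<^sup>2) - of_real (- (x\<^sup>2) / 2)) \<le> \<bar>s\<bar> * \<bar>x\<bar> ^ 3 / 6" .
    qed
    show "((\<lambda>s. \<bar>s\<bar> * \<bar>x\<bar> ^ 3 / 6) \<longlongrightarrow> 0) (at 0)"
      by (auto intro!: tendsto_eq_intros)
  qed
  then show ?thesis by (rule LIM_zero_cancel)
qed

text \<open>
  Dominated convergence: the second order remainder, divided by \<open>s\<^sup>2\<close>, is at most \<open>X\<^sup>2 / 2\<close>.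
\<close>
lemma (in prob_space) char_second_order:
  fixes X :: "'a \<Rightarrow> real"
  assumes X: "integrable M X" "expectation X = 0" and X2: "integrable M (\<lambda>\<omega>. (X \<omega>)\<^sup>2)"
  shows "((\<lambda>s. ((CLINT \<omega>|M. iexp (s * X \<omega>)) - 1) / of_real (s\<^sup>2)) \<longlongrightarrow> of_real (- expectation (\<lambda>\<omega>. (X \<omega>)\<^sup>2) / 2)) (at 0)"
  unfolding tendsto_at_iff_sequentially comp_def
proof (intro allI impI)
  fix s :: "nat \<Rightarrow> real"
  assume nz: "\<forall>i. s i \<in> UNIV - {0}" and lim: "s \<longlonglongrightarrow> 0"
  have [measurable]: "X \<in> borel_measurable M" using X(1) by simp
  define R where "R t \<omega> = (iexp (t * X \<omega>) - 1 - \<i> * of_real (t * X \<omega>)) / of_real (t\<^sup>2)" for t \<omega>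
  have "(\<lambda>n. CLINT \<omega>|M. R (s n) \<omega>) \<longlonglongrightarrow> (CLINT \<omega>|M. of_real (- ((X \<omega>)\<^sup>2) / 2))"
  proof (rule integral_dominated_convergence[where w = "\<lambda>\<omega>. (X \<omega>)\<^sup>2 / 2"])
    show "AE \<omega> in M. (\<lambda>n. R (s n) \<omega>) \<longlonglongrightarrow> of_real (- ((X \<omega>)\<^sup>2) / 2)"
      using iexp_second_order_pointwise nz lim
      unfolding tendsto_at_iff_sequentially comp_def R_def by auto
    show "AE \<omega> in M. norm (R (s n) \<omega>) \<le> (X \<omega>)\<^sup>2 / 2" for n
    proof (rule AE_I2)
      fix \<omega>
      have "norm (iexp (s n * X \<omega>) - 1 - \<i> * of_real (s n * X \<omega>)) \<le> (s n * X \<omega>)\<^sup>2 / 2"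
        using iexp_approx1[of "s n * X \<omega>" 1] by (simp add: numeral_2_eq_2 algebra_simps)
      then have "norm (R (s n) \<omega>) \<le> ((s n * X \<omega>)\<^sup>2 / 2) / (s n)\<^sup>2"
        unfolding R_def norm_divide norm_of_real abs_power2 by (rule divide_right_mono) simp
      also have "\<dots> = (X \<omega>)\<^sup>2 / 2"
        using nz by (simp add: power_mult_distrib)
      finally show "norm (R (s n) \<omega>) \<le> (X \<omega>)\<^sup>2 / 2" .
    qed
  qed (use X2 in \<open>auto simp: R_def\<close>)
  moreover have "(CLINT \<omega>|M. R t \<omega>) = ((CLINT \<omega>|M. iexp (t * X \<omega>)) - 1) / of_real (t\<^sup>2)" for t
  proof -
    have "complex_integrable M (\<lambda>\<omega>. iexp (t * X \<omega>))"
      by (rule integrable_const_bound[of _ 1]) auto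
    moreover have "complex_integrable M (\<lambda>\<omega>. \<i> * of_real (t * X \<omega>))"
      using X(1) by simp
    moreover have "(CLINT \<omega>|M. \<i> * of_real (t * X \<omega>)) = 0"
      using X by simp
    ultimately show ?thesis
      unfolding R_def by (simp add: prob_space)
  qed
  ultimately show "(\<lambda>n. ((CLINT \<omega>|M. iexp (s n * X \<omega>)) - 1) / of_real ((s n)\<^sup>2)) \<longlonglongrightarrow> of_real (- expectation (\<lambda>\<omega>. (X \<omega>)\<^sup>2) / 2)"
    by (simp flip: of_real_minus of_real_divide of_real_power add: integral_complex_of_real)
qed

lemma prod_second_order:
  fixes f :: "'i \<Rightarrow> real \<Rightarrow> complex"
  assumes "finite I" "\<And>i. i \<in> I \<Longrightarrow> ((\<lambda>s. (f i s - 1) / of_real (s\<^sup>2)) \<longlongrightarrow> c i) (at 0)"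
  shows "((\<lambda>s. ((\<Prod>i\<in>I. f i s) - 1) / of_real (s\<^sup>2)) \<longlongrightarrow> (\<Sum>i\<in>I. c i)) (at 0)"
  using assms
proof (induction I rule: finite_induct)
  case empty
  then show ?case by simp
next
  case (insert j I)
  define P where "P s = (\<Prod>i\<in>I. f i s)" for s
  have IH: "((\<lambda>s. (P s - 1) / of_real (s\<^sup>2)) \<longlongrightarrow> (\<Sum>i\<in>I. c i)) (at 0)"
    unfolding P_def using insert by simp
  have fj: "((\<lambda>s. (f j s - 1) / of_real (s\<^sup>2)) \<longlongrightarrow> c j) (at 0)" using insert by simp
  have "((\<lambda>s. (P s - 1) / of_real (s\<^sup>2) * of_real (s\<^sup>2) + 1) \<longlongrightarrow> (\<Sum>i\<in>I. c i) * of_real (0\<^sup>2) + 1) (at 0)"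
    by (intro tendsto_intros IH)
  then have "(P \<longlongrightarrow> 1) (at 0)"
    by (rule Lim_transform_eventually[THEN tendsto_eq_rhs]) (auto simp: eventually_at_filter)
  then have "((\<lambda>s. (f j s - 1) / of_real (s\<^sup>2) * P s + (P s - 1) / of_real (s\<^sup>2)) \<longlongrightarrow> c j * 1 + (\<Sum>i\<in>I. c i)) (at 0)"
    by (intro tendsto_intros fj IH)
  moreover have "(f j s - 1) / of_real (s\<^sup>2) * P s + (P s - 1) / of_real (s\<^sup>2) = (f j s * P s - 1) / of_real (s\<^sup>2)" for s
    by (simp add: left_diff_distrib diff_divide_distrib)
  ultimately show ?case using insert by (simp add: P_def)
qed

text \<open>
  The characteristic function of the projection of \<open>Ln (1 - U)\<close> to the direction \<open>c\<close>, with \<open>U\<close> uniform on the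
  circle.
\<close>
definition log_char :: "complex \<Rightarrow> real \<Rightarrow> complex" where
  "log_char c s = (CLINT w|uniform_circle. iexp (s * (c \<bullet> Ln (1 - w))))"

lemma prod_log_char_second_order:
  fixes t :: "complex ^ 'd::finite"
  shows "((\<lambda>s. ((\<Prod>j\<in>UNIV. log_char (t $ j) s) - 1) / of_real (s\<^sup>2)) \<longlongrightarrow> of_real (- (norm t)\<^sup>2 * (pi\<^sup>2 / 24))) (at 0)"
proof -
  interpret prob_space uniform_circle by (rule prob_space_uniform_circle)
  have "((\<lambda>s. (log_char (t $ j) s - 1) / of_real (s\<^sup>2)) \<longlongrightarrow> of_real (- ((norm (t $ j))\<^sup>2 * (pi\<^sup>2 / 12)) / 2)) (at 0)" for j
    using char_second_order[OF Ln_projection_moments(1,2,3)[of "t $ j"]]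
    unfolding log_char_def Ln_projection_moments(4) .
  then have "((\<lambda>s. ((\<Prod>j\<in>UNIV. log_char (t $ j) s) - 1) / of_real (s\<^sup>2)) \<longlongrightarrow>
      (\<Sum>j\<in>UNIV. of_real (- ((norm (t $ j))\<^sup>2 * (pi\<^sup>2 / 12)) / 2))) (at 0)"
    by (intro prod_second_order) auto
  moreover have "(\<Sum>j\<in>UNIV. of_real (- ((norm (t $ j))\<^sup>2 * (pi\<^sup>2 / 12)) / 2)) = complex_of_real (- (norm t)\<^sup>2 * (pi\<^sup>2 / 24))"
    by (simp add: norm_vec_def L2_set_def sum_nonneg sum_negf flip: sum_divide_distrib sum_distrib_right)
  ultimately show ?thesis by simp
qed

lemma norm_prod_log_char_le: "norm (\<Prod>j\<in>UNIV. log_char ((t :: complex ^ 'd::finite) $ j) s) \<le> 1"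
proof -
  interpret prob_space uniform_circle by (rule prob_space_uniform_circle)
  have "norm (log_char c s) \<le> 1" for c
  proof -
    have "norm (log_char c s) \<le> (\<integral>w. norm (iexp (s * (c \<bullet> Ln (1 - w)))) \<partial>uniform_circle)"
      unfolding log_char_def by (rule integral_norm_bound)
    then show ?thesis using prob_space by simp
  qed
  then show ?thesis
    by (auto simp flip: prod_norm intro!: prod_le_1)
qed

text \<open>
  The normalisation is chosen so that \<open>(s n)\<^sup>2 = 1 / (\<pi>\<^sup>2/12 \<theta> ln n)\<close>. Since \<open>u(s) - 1 \<sim> - \<bar>t\<bar>\<^sup>2 (\<pi>\<^sup>2/24) s\<^sup>2\<close>, the product
  \<open>ln n (u (s n) - 1)\<close> tends to \<open>- \<bar>t\<bar>\<^sup>2 / (2 \<theta>)\<close>.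
\<close>
lemma ewens_char_limit:
  fixes t :: "complex ^ 'd::finite"
  assumes "\<theta> > 0"
  defines "s n \<equiv> 1 / sqrt (pi\<^sup>2 / 12 * \<theta> * ln (real n))"
  shows "(\<lambda>n. pochhammer (of_real \<theta> * (\<Prod>j\<in>UNIV. log_char (t $ j) (s n))) n / of_real (pochhammer \<theta> n))
     \<longlonglongrightarrow> of_real (exp (- (norm t)\<^sup>2 / 2))"
proof -
  define U where "U s = (\<Prod>j\<in>UNIV. log_char (t $ j) s)" for s
  have s0: "s \<longlonglongrightarrow> 0" unfolding s_def using assms(1) by real_asymp
  \<comment> \<open>For \<open>n \<le> 1\<close> the logarithm vanishes and \<open>s n\<close> is the default value \<open>0\<close> of the division.\<close>
  have ev: "\<forall>\<^sub>F n in sequentially. s n \<noteq> 0"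
    using eventually_ge_at_top[of 2] by eventually_elim (use assms(1) in \<open>simp add: s_def\<close>)
  have "filterlim s (at 0) sequentially"
    using s0 ev by (simp add: filterlim_at)
  from filterlim_compose[OF prod_log_char_second_order this]
  have "(\<lambda>n. (U (s n) - 1) / of_real ((s n)\<^sup>2)) \<longlonglongrightarrow> of_real (- (norm t)\<^sup>2 * (pi\<^sup>2 / 24))"
    unfolding U_def .
  then have "(\<lambda>n. (U (s n) - 1) / of_real ((s n)\<^sup>2) / of_real (pi\<^sup>2 / 12 * \<theta>)) \<longlonglongrightarrow>
      of_real (- (norm t)\<^sup>2 * (pi\<^sup>2 / 24)) / of_real (pi\<^sup>2 / 12 * \<theta>)"
    by (rule tendsto_divide[OF _ tendsto_const]) (use assms(1) in simp)
  moreover have "\<forall>\<^sub>F n in sequentially. (U (s n) - 1) / of_real ((s n)\<^sup>2) / of_real (pi\<^sup>2 / 12 * \<theta>) = of_real (ln (real n)) * (U (s n) - 1)"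
    using eventually_ge_at_top[of 2]
  proof eventually_elim
    case (elim n)
    have sq: "(s n)\<^sup>2 = 1 / (pi\<^sup>2 / 12 * \<theta> * ln (real n))"
      unfolding s_def using elim assms(1) by (simp add: power_divide)
    show ?case
      unfolding sq using assms(1) by (simp add: field_simps)
  qed
  ultimately have "(\<lambda>n. of_real (ln (real n)) * (U (s n) - 1)) \<longlonglongrightarrow>
      of_real (- (norm t)\<^sup>2 * (pi\<^sup>2 / 24)) / of_real (pi\<^sup>2 / 12 * \<theta>)"
    by (rule Lim_transform_eventually)
  from pochhammer_ratio_limit[OF assms(1) _ this]
  have "(\<lambda>n. pochhammer (of_real \<theta> * U (s n)) n / of_real (pochhammer \<theta> n)) \<longlonglongrightarrow>
      exp (of_real \<theta> * (of_real (- (norm t)\<^sup>2 * (pi\<^sup>2 / 24)) / of_real (pi\<^sup>2 / 12 * \<theta>)))"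
    using norm_prod_log_char_le[of t] unfolding U_def by blast
  also have "of_real \<theta> * (of_real (- (norm t)\<^sup>2 * (pi\<^sup>2 / 24)) / of_real (pi\<^sup>2 / 12 * \<theta>)) = complex_of_real (- (norm t)\<^sup>2 / 2)"
    using assms(1) by (simp add: field_simps)
  finally show ?thesis
    unfolding U_def exp_of_real .
qed

section \<open>Uniform points of the torus\<close>

lemma measurable_component_vec [measurable]: "(\<lambda>v::complex ^ 'd::finite. v $ j) \<in> borel_measurable borel"
  by (intro borel_measurable_continuous_onI continuous_intros)

lemma borel_measurable_vec_lambda:
  fixes f :: "'d::finite \<Rightarrow> 'a \<Rightarrow> complex"
  assumes f: "\<And>j. f j \<in> borel_measurable M"
  shows "(\<lambda>x. \<chi> j. f j x) \<in> borel_measurable M"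
proof (rule borel_measurable_euclidean_space[THEN iffD2], rule ballI)
  fix b :: "complex ^ 'd" assume "b \<in> Basis"
  then obtain u i where b: "b = axis i u" unfolding Basis_vec_def by blast
  have "(\<lambda>x. (\<chi> j. f j x) \<bullet> b) = (\<lambda>x. f i x \<bullet> u)"
    by (simp add: b inner_axis)
  then show "(\<lambda>x. (\<chi> j. f j x) \<bullet> b) \<in> borel_measurable M"
    by (simp only: borel_measurable_inner[OF f borel_measurable_const])
qed
text \<open>
  The Haar probability measure of the torus. Test functions of product form determine it, and they are the
  form in which the components of a characteristic function enter.
\<close>
definition uniform_torus :: "(complex ^ 'd::finite) measure \<Rightarrow> bool" where
  "uniform_torus \<nu> \<longleftrightarrow> prob_space \<nu> \<and> sets \<nu> = sets borel \<and> (AE v in \<nu>. \<forall>j. norm (v $ j) = 1) \<and>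
     (\<forall>g :: 'd \<Rightarrow> complex \<Rightarrow> complex.
        (\<forall>j. g j \<in> borel_measurable borel) \<longrightarrow> (\<forall>j w. norm (g j w) \<le> 1) \<longrightarrow>
        (\<integral>v. (\<Prod>j\<in>UNIV. g j (v $ j)) \<partial>\<nu>) = (\<Prod>j\<in>UNIV. \<integral>w. g j w \<partial>uniform_circle))"

lemma uniform_torus_integral:
  fixes \<nu> :: "(complex ^ 'd::finite) measure" and g :: "'d \<Rightarrow> complex \<Rightarrow> complex"
  assumes "uniform_torus \<nu>" "\<And>j. g j \<in> borel_measurable borel" "\<And>j w. norm (g j w) \<le> 1"
  shows "(\<integral>v. (\<Prod>j\<in>UNIV. g j (v $ j)) \<partial>\<nu>) = (\<Prod>j\<in>UNIV. \<integral>w. g j w \<partial>uniform_circle)"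
proof -
  have "\<forall>g :: 'd \<Rightarrow> complex \<Rightarrow> complex.
      (\<forall>j. g j \<in> borel_measurable borel) \<longrightarrow> (\<forall>j w. norm (g j w) \<le> 1) \<longrightarrow>
      (\<integral>v. (\<Prod>j\<in>UNIV. g j (v $ j)) \<partial>\<nu>) = (\<Prod>j\<in>UNIV. \<integral>w. g j w \<partial>uniform_circle)"
    using assms(1) unfolding uniform_torus_def by (elim conjE)
  from spec[OF this, of g] show ?thesis
    using assms(2,3) by (elim mp[THEN mp]) blast+
qed

lemma uniform_torus_rotate:
  fixes \<nu> :: "(complex ^ 'd::finite) measure" and g :: "'d \<Rightarrow> complex \<Rightarrow> complex"
  assumes \<nu>: "uniform_torus \<nu>" and g: "\<And>j. g j \<in> borel_measurable borel" "\<And>j w. norm (g j w) \<le> 1"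
    and c: "\<And>j. norm (c j) = 1"
  shows "(\<integral>v. (\<Prod>j\<in>UNIV. g j (c j * v $ j)) \<partial>\<nu>) = (\<Prod>j\<in>UNIV. \<integral>w. g j w \<partial>uniform_circle)"
proof -
  have "(\<integral>v. (\<Prod>j\<in>UNIV. g j (c j * v $ j)) \<partial>\<nu>) = (\<Prod>j\<in>UNIV. \<integral>w. g j (c j * w) \<partial>uniform_circle)"
  proof (rule uniform_torus_integral[OF \<nu>, where g = "\<lambda>j w. g j (c j * w)"])
    show "(\<lambda>w. g j (c j * w)) \<in> borel_measurable borel" for j
      by (rule measurable_compose[OF _ g(1)]) simp
  qed (rule g(2))
  also have "\<dots> = (\<Prod>j\<in>UNIV. \<integral>w. g j w \<partial>uniform_circle)"
  proof (rule prod.cong)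
    fix j
    show "(\<integral>w. g j (c j * w) \<partial>uniform_circle) = (\<integral>w. g j w \<partial>uniform_circle)"
      by (rule integral_uniform_circle_rotate[OF g(1) g(2) c])
  qed simp
  finally show ?thesis .
qed

text \<open>
  One of the \<open>m\<close> factors is integrated first, the others being fixed: they act on it, together with \<open>c\<close>, as a
  rotation, which the uniform law absorbs. The inner integral is thus constant. The factor to be split off
  is the reason for \<open>m \<ge> 1\<close>.
\<close>
lemma uniform_torus_product:
  fixes \<nu> :: "(complex ^ 'd::finite) measure" and g :: "'d \<Rightarrow> complex \<Rightarrow> complex"
  assumes \<nu>: "uniform_torus \<nu>" and m: "m \<ge> 1"
    and g [measurable]: "\<And>j. g j \<in> borel_measurable borel" and g1: "\<And>j w. norm (g j w) \<le> 1"
    and c: "\<And>j. norm (c j) = 1"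
  shows "(\<integral>v. (\<Prod>j\<in>UNIV. g j (c j * v $ j)) \<partial>iid_product_law \<nu> m) = (\<Prod>j\<in>UNIV. \<integral>w. g j w \<partial>uniform_circle)"
proof -
  interpret \<nu>: prob_space \<nu> using \<nu> by (simp add: uniform_torus_def)
  have sets [measurable_cong]: "sets \<nu> = sets borel" using \<nu> by (simp add: uniform_torus_def)
  interpret P: product_prob_space "\<lambda>_::nat. \<nu>" by unfold_locales
  have mI: "{1..m} = insert m {1..<m}" using m by auto
  define F where "F w = (\<Prod>j\<in>UNIV. g j (c j * (\<Prod>i\<in>{1..m}. w i $ j)))" for w :: "nat \<Rightarrow> complex ^ 'd"
  have meas [measurable]: "(\<lambda>w. \<chi> j. \<Prod>i\<in>{1..m}. w i $ j) \<in> Pi\<^sub>M {1..m} (\<lambda>_. \<nu>) \<rightarrow>\<^sub>M borel"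
    by (intro borel_measurable_vec_lambda) measurable
  have F [measurable]: "F \<in> borel_measurable (Pi\<^sub>M {1..m} (\<lambda>_. \<nu>))"
    unfolding F_def by measurable
  have F1: "norm (F w) \<le> 1" for w
    unfolding F_def using g1 by (auto simp flip: prod_norm intro!: prod_le_1)
  interpret Pm: prob_space "Pi\<^sub>M {1..m} (\<lambda>_. \<nu>)" by (rule prob_space_PiM) unfold_locales
  interpret Pk: prob_space "Pi\<^sub>M {1..<m} (\<lambda>_. \<nu>)" by (rule prob_space_PiM) unfold_locales
  have "(\<integral>v. (\<Prod>j\<in>UNIV. g j (c j * v $ j)) \<partial>iid_product_law \<nu> m) = (\<integral>w. F w \<partial>Pi\<^sub>M {1..m} (\<lambda>_. \<nu>))"
    unfolding iid_product_law_def F_def by (subst integral_distr[OF meas], measurable)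
  also have "\<dots> = (\<integral>w. F w \<partial>Pi\<^sub>M (insert m {1..<m}) (\<lambda>_. \<nu>))"
    by (rule arg_cong[where f = "\<lambda>I. integral\<^sup>L (Pi\<^sub>M I (\<lambda>_. \<nu>)) F"]) (use m in auto)
  also have "(\<integral>w. F w \<partial>Pi\<^sub>M (insert m {1..<m}) (\<lambda>_. \<nu>)) = (\<integral>w. (\<integral>y. F (w(m := y)) \<partial>\<nu>) \<partial>Pi\<^sub>M {1..<m} (\<lambda>_. \<nu>))"
  proof (rule P.product_integral_insert)
    have "integrable (Pi\<^sub>M {1..m} (\<lambda>_. \<nu>)) F"
      by (rule Pm.integrable_const_bound[of _ 1]) (rule AE_I2, rule F1, rule F)
    then show "integrable (Pi\<^sub>M (insert m {1..<m}) (\<lambda>_. \<nu>)) F" unfolding mI .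
  qed auto
  also have "\<dots> = (\<integral>w. (\<Prod>j\<in>UNIV. \<integral>w. g j w \<partial>uniform_circle) \<partial>Pi\<^sub>M {1..<m} (\<lambda>_. \<nu>))"
  proof (rule integral_cong_AE)
    have Fup: "F (w(m := y)) = (\<Prod>j\<in>UNIV. g j ((c j * (\<Prod>i\<in>{1..<m}. w i $ j)) * y $ j))" for w y
    proof -
      have "(\<Prod>i\<in>{1..m}. (w(m := y)) i $ j) = y $ j * (\<Prod>i\<in>{1..<m}. w i $ j)" for j
      proof -
        have "(\<Prod>i\<in>{1..<m}. (w(m := y)) i $ j) = (\<Prod>i\<in>{1..<m}. w i $ j)"
          by (rule prod.cong) auto
        then show ?thesis unfolding mI by (subst prod.insert, simp, simp, simp only: fun_upd_same)
      qed
      then show ?thesis unfolding F_def by (simp only: mult_ac)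
    qed
    have "AE w in Pi\<^sub>M {1..<m} (\<lambda>_. \<nu>). \<forall>i\<in>{1..<m}. \<forall>j. norm (w i $ j) = 1"
      using \<nu> unfolding uniform_torus_def
      by (intro AE_finite_allI AE_PiM_component[where P = "\<lambda>v. \<forall>j. norm (v $ j) = 1"]) (auto intro: \<nu>.prob_space_axioms)
    then show "AE w in Pi\<^sub>M {1..<m} (\<lambda>_. \<nu>). (\<integral>y. F (w(m := y)) \<partial>\<nu>) = (\<Prod>j\<in>UNIV. \<integral>w. g j w \<partial>uniform_circle)"
    proof eventually_elim
      case (elim w)
      then have "norm (c j * (\<Prod>i\<in>{1..<m}. w i $ j)) = 1" for j
        unfolding norm_mult c prod_norm[symmetric] by simp
      then show ?case
        unfolding Fup by (intro uniform_torus_rotate[OF \<nu> g g1])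
    qed
    show "(\<lambda>w. \<integral>y. F (w(m := y)) \<partial>\<nu>) \<in> borel_measurable (Pi\<^sub>M {1..<m} (\<lambda>_. \<nu>))"
      unfolding Fup by measurable
  qed simp
  also have "\<dots> = (\<Prod>j\<in>UNIV. \<integral>w. g j w \<partial>uniform_circle)"
    using Pk.prob_space by simp
  finally show ?thesis .
qed

lemma uniform_torusI_indep:
  fixes z :: "'v \<Rightarrow> complex ^ 'd::finite"
  assumes "prob_space Mz" and z: "z \<in> borel_measurable Mz"
    and torus: "\<And>\<omega> j. \<omega> \<in> space Mz \<Longrightarrow> z \<omega> $ j \<in> sphere 0 1"
    and unif: "\<And>j. distr Mz borel (\<lambda>\<omega>. z \<omega> $ j) = uniform_circle"
    and indep: "prob_space.indep_vars Mz (\<lambda>_. borel) (\<lambda>j \<omega>. z \<omega> $ j) UNIV"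
  shows "uniform_torus (distr Mz borel z)"
  unfolding uniform_torus_def
proof (intro conjI allI impI)
  interpret prob_space Mz by fact
  note [measurable] = z
  show "prob_space (distr Mz borel z)" by (rule prob_space_distr) fact
  show "AE v in distr Mz borel z. \<forall>j. norm (v $ j) = 1"
    by (subst AE_distr_iff) (use torus in auto)
  fix g :: "'d \<Rightarrow> complex \<Rightarrow> complex"
  assume "\<forall>j. g j \<in> borel_measurable borel" and g1: "\<forall>j w. norm (g j w) \<le> 1"
  then have g [measurable]: "\<And>j. g j \<in> borel_measurable borel" by simp
  have "(\<integral>v. (\<Prod>j\<in>UNIV. g j (v $ j)) \<partial>distr Mz borel z) = (\<integral>\<omega>. (\<Prod>j\<in>UNIV. g j (z \<omega> $ j)) \<partial>Mz)"
    by (subst integral_distr) auto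
  also have "\<dots> = (\<Prod>j\<in>UNIV. \<integral>\<omega>. g j (z \<omega> $ j) \<partial>Mz)"
  proof (rule indep_vars_lebesgue_integral)
    show "indep_vars (\<lambda>_. borel) (\<lambda>j \<omega>. g j (z \<omega> $ j)) UNIV"
      by (rule indep_vars_compose2[OF indep g])
    show "integrable Mz (\<lambda>\<omega>. g j (z \<omega> $ j))" for j
      using g1 by (intro integrable_const_bound[of _ 1]) auto
  qed simp
  also have "\<dots> = (\<Prod>j\<in>UNIV. \<integral>w. g j w \<partial>uniform_circle)"
  proof (rule prod.cong)
    fix j
    show "(\<integral>\<omega>. g j (z \<omega> $ j) \<partial>Mz) = (\<integral>w. g j w \<partial>uniform_circle)"
      unfolding unif[of j, symmetric] by (subst integral_distr) auto
  qed simp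
  finally show "(\<integral>v. (\<Prod>j\<in>UNIV. g j (v $ j)) \<partial>distr Mz borel z) = (\<Prod>j\<in>UNIV. \<integral>w. g j w \<partial>uniform_circle)" .
qed simp

section \<open>Characteristic functions of the random vectors\<close>

text \<open>
  Conditioning on a random variable with finitely many values. The indicators of its values and the functions of
  the other variable have the same type, so that the product formula for independent variables applies.
\<close>
lemma indep_rv_expectation:
  fixes g :: "'a \<Rightarrow> 'b \<Rightarrow> complex"
  assumes "prob_space M" and A: "finite A" and indep: "indep_rv M (count_space A) X B Y"
    and g: "\<And>a. a \<in> A \<Longrightarrow> g a \<in> borel_measurable B" "\<And>a y. a \<in> A \<Longrightarrow> norm (g a y) \<le> 1"
  shows "(\<integral>\<omega>. g (X \<omega>) (Y \<omega>) \<partial>M)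
    = (\<Sum>a\<in>A. of_real (measure (distr M (count_space A) X) {a}) * (\<integral>\<omega>. g a (Y \<omega>) \<partial>M))"
proof -
  interpret prob_space M by fact
  have X [measurable]: "X \<in> M \<rightarrow>\<^sub>M count_space A" and Y [measurable]: "Y \<in> M \<rightarrow>\<^sub>M B"
    using indep by (simp_all add: indep_rv_def)
  have XA: "X \<omega> \<in> A" if "\<omega> \<in> space M" for \<omega>
    using measurable_space[OF X that] by simp
  have gY: "(\<lambda>\<omega>. g a (Y \<omega>)) \<in> borel_measurable M" if "a \<in> A" for a
    using measurable_compose[OF Y g(1)[OF that]] .
  have int_g: "complex_integrable M (\<lambda>\<omega>. g a (Y \<omega>))" if "a \<in> A" for a
    using gY that g(2) by (intro integrable_const_bound[of _ 1]) auto
  have ind: "(\<lambda>\<omega>. indicator {a} (X \<omega>) :: complex) \<in> borel_measurable M" for a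
    by (rule measurable_compose[OF X]) simp
  have int_i: "complex_integrable M (\<lambda>\<omega>. indicator {a} (X \<omega>))" for a
    using ind by (intro integrable_const_bound[of _ 1]) (auto simp: indicator_def)
  have iv: "indep_var borel (\<lambda>\<omega>. indicator {a} (X \<omega>) :: complex) borel (\<lambda>\<omega>. g a (Y \<omega>))" if a: "a \<in> A" for a
    unfolding indep_var_eq
  proof (intro conjI)
    have sub: "sigma_sets (space M) {(\<lambda>\<omega>. f (Z \<omega>)) -` S \<inter> space M |S. S \<in> sets borel} \<subseteq> sets (vimage_algebra (space M) Z N)"
      if Z: "Z \<in> M \<rightarrow>\<^sub>M N" and f: "f \<in> borel_measurable N" for f :: "'z \<Rightarrow> complex" and Z N
    proof -
      have "Z \<in> vimage_algebra (space M) Z N \<rightarrow>\<^sub>M N"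
        using measurable_space[OF Z] by (intro measurable_vimage_algebra1) auto
      from measurable_sets[OF measurable_compose[OF this f]]
      have "{(\<lambda>\<omega>. f (Z \<omega>)) -` S \<inter> space M |S. S \<in> sets borel} \<subseteq> sets (vimage_algebra (space M) Z N)"
        by auto
      from sets.sigma_sets_subset[OF this] show ?thesis by simp
    qed
    have "indep_set (sets (vimage_algebra (space M) X (count_space A))) (sets (vimage_algebra (space M) Y B))"
      using indep by (simp add: indep_rv_def)
    then show "indep_set
        (sigma_sets (space M) {(\<lambda>\<omega>. indicator {a} (X \<omega>) :: complex) -` S \<inter> space M |S. S \<in> sets borel})
        (sigma_sets (space M) {(\<lambda>\<omega>. g a (Y \<omega>)) -` S \<inter> space M |S. S \<in> sets borel})"
      unfolding indep_set_def
      by (rule indep_sets_mono_sets)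
         (use sub[OF X, of "indicator {a}"] sub[OF Y g(1)[OF a]] in \<open>auto split: bool.split\<close>)
  qed (use ind gY a in auto)
  have "(\<integral>\<omega>. g (X \<omega>) (Y \<omega>) \<partial>M) = (\<integral>\<omega>. (\<Sum>a\<in>A. indicator {a} (X \<omega>) * g a (Y \<omega>)) \<partial>M)"
  proof (rule Bochner_Integration.integral_cong)
    fix \<omega> assume \<omega>: "\<omega> \<in> space M"
    have "(\<Sum>a\<in>A. indicator {a} (X \<omega>) * g a (Y \<omega>)) = (\<Sum>a\<in>A. if a = X \<omega> then g a (Y \<omega>) else 0)"
      by (intro sum.cong) (auto simp: indicator_def)
    then show "g (X \<omega>) (Y \<omega>) = (\<Sum>a\<in>A. indicator {a} (X \<omega>) * g a (Y \<omega>))"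
      using XA[OF \<omega>] A by simp
  qed simp
  also have "\<dots> = (\<Sum>a\<in>A. \<integral>\<omega>. indicator {a} (X \<omega>) * g a (Y \<omega>) \<partial>M)"
    using indep_var_integrable[OF iv int_i int_g] by (intro Bochner_Integration.integral_sum) auto
  also have "\<dots> = (\<Sum>a\<in>A. (\<integral>\<omega>. indicator {a} (X \<omega>) \<partial>M) * (\<integral>\<omega>. g a (Y \<omega>) \<partial>M))"
    using indep_var_lebesgue_integral[OF iv int_i int_g] by (intro sum.cong) auto
  also have "\<dots> = (\<Sum>a\<in>A. of_real (measure (distr M (count_space A) X) {a}) * (\<integral>\<omega>. g a (Y \<omega>) \<partial>M))"
  proof (rule sum.cong)
    fix a assume a: "a \<in> A"
    have "(\<integral>\<omega>. indicator {a} (X \<omega>) \<partial>M) = (\<integral>\<omega>. complex_of_real (indicator (X -` {a} \<inter> space M) \<omega>) \<partial>M)"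
      by (rule Bochner_Integration.integral_cong) (auto simp: indicator_def)
    also have "\<dots> = of_real (prob (X -` {a} \<inter> space M))"
      unfolding integral_complex_of_real by simp
    also have "prob (X -` {a} \<inter> space M) = measure (distr M (count_space A) X) {a}"
      using a by (subst measure_distr) auto
    finally show "(\<integral>\<omega>. indicator {a} (X \<omega>) \<partial>M) * (\<integral>\<omega>. g a (Y \<omega>) \<partial>M)
        = of_real (measure (distr M (count_space A) X) {a}) * (\<integral>\<omega>. g a (Y \<omega>) \<partial>M)"
      by simp
  qed simp
  finally show ?thesis .
qed

lemma finite_S_n: "finite (S_n n)"
  by (rule finite_permutations) simp

lemma ewens_generating_function:
  assumes "\<theta> > 0"
  shows "(\<Sum>p\<in>S_n n. of_real (measure (ewens \<theta> n) {p}) * u ^ num_cycles n p)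
    = pochhammer (of_real \<theta> * u) n / (of_real (pochhammer \<theta> n) :: complex)"
proof -
  have "measure (ewens \<theta> n) {p} = \<theta> ^ num_cycles n p / pochhammer \<theta> n" if "p \<in> S_n n" for p
    using that assms pochhammer_pos[of \<theta> n] unfolding ewens_def measure_def
    by (subst emeasure_point_measure_finite[OF finite_S_n]) auto
  then have "(\<Sum>p\<in>S_n n. of_real (measure (ewens \<theta> n) {p}) * u ^ num_cycles n p)
      = (\<Sum>p\<in>S_n n. (of_real \<theta> * u) ^ num_cycles n p / of_real (pochhammer \<theta> n))"
    by (intro sum.cong) (simp_all add: power_mult_distrib)
  also have "\<dots> = pochhammer (of_real \<theta> * u) n / of_real (pochhammer \<theta> n)"
    unfolding sum_divide_distrib[symmetric] sum_permutations_power_num_cycles ..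
  finally show ?thesis .
qed

lemma char_gaussian_vector:
  fixes N :: "'u \<Rightarrow> complex ^ 'd::finite"
  assumes "prob_space MN" and N: "N \<in> borel_measurable MN"
    and Re: "\<And>j. distributed MN lborel (\<lambda>\<omega>. Re (N \<omega> $ j)) std_normal_density"
    and Im: "\<And>j. distributed MN lborel (\<lambda>\<omega>. Im (N \<omega> $ j)) std_normal_density"
    and indep: "prob_space.indep_vars MN (\<lambda>_. borel)
          (\<lambda>i \<omega>. case i of Inl j \<Rightarrow> Re (N \<omega> $ j) | Inr j \<Rightarrow> Im (N \<omega> $ j))
          (UNIV :: ('d + 'd) set)"
  shows "(CLINT x|distr MN borel N. iexp (t \<bullet> x)) = of_real (exp (- (norm t)\<^sup>2 / 2))"
proof -
  interpret prob_space MN by fact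
  define V where "V i \<omega> = (case i of Inl j \<Rightarrow> Re (N \<omega> $ j) | Inr j \<Rightarrow> Im (N \<omega> $ j))" for i :: "'d + 'd" and \<omega>
  define a where "a i = (case i of Inl j \<Rightarrow> Re (t $ j) | Inr j \<Rightarrow> Im (t $ j))" for i :: "'d + 'd"
  have V: "distributed MN lborel (V i) std_normal_density" for i
    using Re Im by (cases i) (simp_all add: V_def[abs_def])
  have meas [measurable]: "V i \<in> borel_measurable MN" for i
    using distributed_measurable[OF V[of i]] by simp
  have sum_eq: "sum f (UNIV :: ('d + 'd) set) = (\<Sum>j\<in>UNIV. f (Inl j) + f (Inr j))" for f :: "'d + 'd \<Rightarrow> real"
    by (subst UNIV_Plus_UNIV[symmetric], subst sum.Plus) (auto simp: sum.distrib)
  have marg: "(CLINT \<omega>|MN. iexp (b * V i \<omega>)) = of_real (exp (- b\<^sup>2 / 2))" for b i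
  proof -
    have "(CLINT \<omega>|MN. iexp (b * V i \<omega>)) = (CLINT y|distr MN lborel (V i). iexp (b * y))"
      by (subst integral_distr) auto
    also have "distr MN lborel (V i) = std_normal_distribution"
      using distributed_distr_eq_density[OF V] by simp
    also have "(CLINT y|std_normal_distribution. iexp (b * y)) = char std_normal_distribution b"
      by (simp add: char_def)
    finally show ?thesis by (simp add: char_std_normal_distribution)
  qed
  have "(CLINT x|distr MN borel N. iexp (t \<bullet> x)) = (CLINT \<omega>|MN. iexp (t \<bullet> N \<omega>))"
    using N by (subst integral_distr) auto
  also have "\<dots> = (CLINT \<omega>|MN. (\<Prod>i\<in>UNIV. iexp (a i * V i \<omega>)))"
  proof -
    have "t \<bullet> N \<omega> = (\<Sum>i\<in>UNIV. a i * V i \<omega>)" for \<omega>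
      unfolding sum_eq by (simp add: a_def V_def inner_vec_def inner_complex_def)
    then have "iexp (t \<bullet> N \<omega>) = (\<Prod>i\<in>UNIV. iexp (a i * V i \<omega>))" for \<omega>
      by (simp add: sum_distrib_left flip: exp_sum)
    then show ?thesis by simp
  qed
  also have "\<dots> = (\<Prod>i\<in>UNIV. CLINT \<omega>|MN. iexp (a i * V i \<omega>))"
  proof (rule indep_vars_lebesgue_integral)
    have "indep_vars (\<lambda>_. borel) V UNIV"
      using indep by (simp add: V_def[abs_def])
    then show "indep_vars (\<lambda>_. borel) (\<lambda>i \<omega>. iexp (a i * V i \<omega>)) UNIV"
      by (rule indep_vars_compose2) measurable
    show "complex_integrable MN (\<lambda>\<omega>. iexp (a i * V i \<omega>))" for i
      by (rule integrable_const_bound[of _ 1]) auto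
  qed simp
  also have "\<dots> = of_real (exp (\<Sum>i\<in>UNIV. - (a i)\<^sup>2 / 2))"
    by (simp only: marg exp_sum[OF finite] of_real_prod)
  also have "(\<Sum>i\<in>UNIV. - (a i)\<^sup>2 / 2) = (\<Sum>j\<in>UNIV. - (norm (t $ j))\<^sup>2 / 2)"
    unfolding sum_eq by (intro sum.cong) (simp_all add: a_def cmod_power2 field_simps)
  also have "\<dots> = - (norm t)\<^sup>2 / 2"
    by (simp add: norm_vec_def L2_set_def sum_nonneg sum_negf flip: sum_divide_distrib)
  finally show ?thesis .
qed

text \<open>
  The indices \<open>(m, k)\<close> of the vectors \<open>T\<^sup>(\<^sup>m\<^sup>,\<^sup>k\<^sup>)\<close> that enter \<open>log Z\<close>; there is one for each cycle.
\<close>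
definition cycle_slots :: "nat \<Rightarrow> (nat \<Rightarrow> nat) \<Rightarrow> (nat \<times> nat) set" where
  "cycle_slots n p = (SIGMA m:{1..n}. {1..num_cycles_of_length n p m})"

lemma finite_cycle_slots [simp]: "finite (cycle_slots n p)"
  by (simp add: cycle_slots_def)

lemma card_cycle_slots: "p permutes {1..n} \<Longrightarrow> card (cycle_slots n p) = num_cycles n p"
  by (simp add: cycle_slots_def sum_num_cycles_of_length[symmetric])

lemma cycle_slots_subset: "cycle_slots n p \<subseteq> {1..} \<times> {1..}"
  by (auto simp: cycle_slots_def)

lemma log_Z_cycle_slots:
  "log_Z n p \<tau> x = (\<Sum>q\<in>cycle_slots n p. Ln (1 - x powi (- int (fst q)) * \<tau> (fst q) (snd q)))"
  unfolding log_Z_def cycle_slots_def by (subst sum.Sigma) (auto simp: case_prod_unfold)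

lemma iexp_inner_log_Z:
  fixes t x :: "complex ^ 'd::finite"
  shows "iexp (t \<bullet> (s *\<^sub>R (\<chi> j. log_Z n p (\<lambda>m k. \<tau> m k $ j) (x $ j))))
    = (\<Prod>q\<in>cycle_slots n p. \<Prod>j\<in>UNIV.
        iexp (s * (t $ j \<bullet> Ln (1 - (x $ j) powi (- int (fst q)) * \<tau> (fst q) (snd q) $ j))))"
proof -
  have "t \<bullet> (s *\<^sub>R (\<chi> j. log_Z n p (\<lambda>m k. \<tau> m k $ j) (x $ j)))
      = (\<Sum>j\<in>UNIV. \<Sum>q\<in>cycle_slots n p.
          s * (t $ j \<bullet> Ln (1 - (x $ j) powi (- int (fst q)) * \<tau> (fst q) (snd q) $ j)))"
    by (simp add: inner_vec_def log_Z_cycle_slots inner_sum_right sum_distrib_left)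
  also have "\<dots> = (\<Sum>q\<in>cycle_slots n p. \<Sum>j\<in>UNIV.
          s * (t $ j \<bullet> Ln (1 - (x $ j) powi (- int (fst q)) * \<tau> (fst q) (snd q) $ j)))"
    by (rule sum.swap)
  finally show ?thesis
    by (simp only: of_real_sum sum_distrib_left exp_sum[OF finite_cycle_slots] exp_sum[OF finite])
qed

text \<open>
  Given the permutation, the vectors indexed by its cycles are independent, and each contributes the same
  factor \<open>u\<close>, whatever the length \<open>m\<close>. The conditional characteristic function is thus \<open>u\<close> to the number of
  cycles, and averaging over the Ewens law evaluates its generating function at \<open>u\<close>.
\<close>
lemma char_log_Z:
  fixes t x :: "complex ^ 'd::finite" and T :: "nat \<Rightarrow> nat \<Rightarrow> 'w \<Rightarrow> complex ^ 'd"
  assumes "\<theta> > 0" and \<nu>: "uniform_torus \<nu>" and x: "\<And>j. norm (x $ j) = 1"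
    and "prob_space M"
    and \<sigma>: "distr M (count_space (S_n n)) \<sigma> = ewens \<theta> n"
    and T_law: "\<And>m k. m \<ge> 1 \<Longrightarrow> k \<ge> 1 \<Longrightarrow> distr M borel (T m k) = iid_product_law \<nu> m"
    and T_indep: "prob_space.indep_vars M (\<lambda>_. borel) (\<lambda>(m, k). T m k) ({1..} \<times> {1..})"
    and \<sigma>_T: "indep_rv M (count_space (S_n n)) \<sigma> (\<Pi>\<^sub>M p\<in>{1..} \<times> {1..}. borel)
            (\<lambda>\<omega>. \<lambda>p\<in>{1..} \<times> {1..}. T (fst p) (snd p) \<omega>)"
  shows "(CLINT \<omega>|M. iexp (t \<bullet> (s *\<^sub>R (\<chi> j. log_Z n (\<sigma> \<omega>) (\<lambda>m k. T m k \<omega> $ j) (x $ j)))))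
    = pochhammer (of_real \<theta> * (\<Prod>j\<in>UNIV. log_char (t $ j) s)) n / of_real (pochhammer \<theta> n)"
proof -
  interpret prob_space M by fact
  define h where "h m v = (\<Prod>j\<in>UNIV. iexp (s * (t $ j \<bullet> Ln (1 - (x $ j) powi (- int m) * v $ j))))"
    for m and v :: "complex ^ 'd"
  have h [measurable]: "h m \<in> borel_measurable borel" for m
    unfolding h_def by measurable
  have h1: "norm (h m v) \<le> 1" for m v
    unfolding h_def by (simp flip: prod_norm)
  define G where "G p y = (\<Prod>q\<in>cycle_slots n p. h (fst q) (y q))" for p and y :: "nat \<times> nat \<Rightarrow> complex ^ 'd"
  define Y where "Y \<omega> = (\<lambda>p\<in>{1..} \<times> {1..}. T (fst p) (snd p) \<omega>)" for \<omega>
  have Y: "Y \<omega> q = T (fst q) (snd q) \<omega>" if "q \<in> cycle_slots n p" for \<omega> q p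
    using that cycle_slots_subset[of n p] by (auto simp: Y_def)
  have T [measurable]: "T m k \<in> borel_measurable M" if "m \<ge> 1" "k \<ge> 1" for m k
    using T_indep that unfolding indep_vars_def by auto
  have mean_h: "(CLINT \<omega>|M. h m (T m k \<omega>)) = (\<Prod>j\<in>UNIV. log_char (t $ j) s)" if "m \<ge> 1" "k \<ge> 1" for m k
  proof -
    have "(CLINT \<omega>|M. h m (T m k \<omega>)) = (CLINT v|distr M borel (T m k). h m v)"
      by (rule integral_distr[symmetric, OF T[OF that] h])
    also have "\<dots> = (CLINT v|iid_product_law \<nu> m. \<Prod>j\<in>UNIV. iexp (s * (t $ j \<bullet> Ln (1 - (x $ j) powi (- int m) * v $ j))))"
      using that by (simp only: T_law h_def)
    also have "\<dots> = (\<Prod>j\<in>UNIV. CLINT w|uniform_circle. iexp (s * (t $ j \<bullet> Ln (1 - w))))"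
      by (rule uniform_torus_product[OF \<nu> that(1), where g = "\<lambda>j w. iexp (s * (t $ j \<bullet> Ln (1 - w)))"])
         (simp_all add: norm_power_int x)
    finally show ?thesis by (simp add: log_char_def)
  qed
  have mean_G: "(CLINT \<omega>|M. G p (Y \<omega>)) = (\<Prod>j\<in>UNIV. log_char (t $ j) s) ^ num_cycles n p" if p: "p \<in> S_n n" for p
  proof -
    have "(CLINT \<omega>|M. G p (Y \<omega>)) = (CLINT \<omega>|M. \<Prod>q\<in>cycle_slots n p. h (fst q) (T (fst q) (snd q) \<omega>))"
      unfolding G_def by (intro Bochner_Integration.integral_cong prod.cong refl) (simp add: Y)
    also have "\<dots> = (\<Prod>q\<in>cycle_slots n p. CLINT \<omega>|M. h (fst q) (T (fst q) (snd q) \<omega>))"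
    proof (rule indep_vars_lebesgue_integral)
      have "indep_vars (\<lambda>_. borel) (\<lambda>(m, k). T m k) (cycle_slots n p)"
        using T_indep cycle_slots_subset by (rule indep_vars_subset)
      from indep_vars_compose2[OF this, of "\<lambda>q. h (fst q)" "\<lambda>_. borel"]
      show "indep_vars (\<lambda>_. borel) (\<lambda>q \<omega>. h (fst q) (T (fst q) (snd q) \<omega>)) (cycle_slots n p)"
        using h by (simp add: case_prod_unfold)
      show "complex_integrable M (\<lambda>\<omega>. h (fst q) (T (fst q) (snd q) \<omega>))" if "q \<in> cycle_slots n p" for q
      proof (rule integrable_const_bound[of _ 1])
        have "T (fst q) (snd q) \<in> borel_measurable M"
          using that cycle_slots_subset[of n p] by (intro T) auto
        then show "(\<lambda>\<omega>. h (fst q) (T (fst q) (snd q) \<omega>)) \<in> borel_measurable M"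
          by (rule measurable_compose[OF _ h])
      qed (simp add: h1)
    qed simp
    also have "\<dots> = (\<Prod>q\<in>cycle_slots n p. \<Prod>j\<in>UNIV. log_char (t $ j) s)"
      using cycle_slots_subset[of n p] by (intro prod.cong refl mean_h) auto
    finally show ?thesis
      using p by (simp add: card_cycle_slots)
  qed
  have "(CLINT \<omega>|M. iexp (t \<bullet> (s *\<^sub>R (\<chi> j. log_Z n (\<sigma> \<omega>) (\<lambda>m k. T m k \<omega> $ j) (x $ j)))))
      = (CLINT \<omega>|M. G (\<sigma> \<omega>) (Y \<omega>))"
    unfolding iexp_inner_log_Z G_def h_def
    by (intro Bochner_Integration.integral_cong prod.cong refl) (simp add: Y)
  also have "\<dots> = (\<Sum>p\<in>S_n n. of_real (measure (distr M (count_space (S_n n)) \<sigma>) {p}) * (CLINT \<omega>|M. G p (Y \<omega>)))"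
  proof (rule indep_rv_expectation[OF prob_space_axioms finite_S_n \<sigma>_T[folded Y_def]])
    show "G p \<in> borel_measurable (\<Pi>\<^sub>M p\<in>{1..} \<times> {1..}. borel)" for p
      unfolding G_def
    proof (rule borel_measurable_prod)
      fix q assume "q \<in> cycle_slots n p"
      then have "q \<in> {1..} \<times> {1..}" using cycle_slots_subset by blast
      then have "(\<lambda>y. y q) \<in> (\<Pi>\<^sub>M p\<in>{1..} \<times> {1..}. (borel :: (complex ^ 'd) measure)) \<rightarrow>\<^sub>M borel"
        by (rule measurable_component_singleton)
      from measurable_compose[OF this h]
      show "(\<lambda>y. h (fst q) (y q)) \<in> borel_measurable (\<Pi>\<^sub>M p\<in>{1..} \<times> {1..}. borel)" .
    qed
    show "norm (G p y) \<le> 1" for p y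
      unfolding G_def by (auto simp flip: prod_norm intro!: prod_le_1 h1)
  qed
  also have "\<dots> = (\<Sum>p\<in>S_n n. of_real (measure (ewens \<theta> n) {p}) * (\<Prod>j\<in>UNIV. log_char (t $ j) s) ^ num_cycles n p)"
    unfolding \<sigma> by (intro sum.cong refl) (simp only: mean_G)
  also have "\<dots> = pochhammer (of_real \<theta> * (\<Prod>j\<in>UNIV. log_char (t $ j) s)) n / of_real (pochhammer \<theta> n)"
    by (rule ewens_generating_function) fact
  finally show ?thesis .
qed

lemma log_Z_vector_measurable:
  fixes x :: "complex ^ 'd::finite" and T :: "nat \<Rightarrow> nat \<Rightarrow> 'w \<Rightarrow> complex ^ 'd"
  assumes \<sigma>: "\<sigma> \<in> M \<rightarrow>\<^sub>M count_space (S_n n)"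
    and T: "\<And>m k. m \<ge> 1 \<Longrightarrow> k \<ge> 1 \<Longrightarrow> T m k \<in> borel_measurable M"
  shows "(\<lambda>\<omega>. s *\<^sub>R (\<chi> j. log_Z n (\<sigma> \<omega>) (\<lambda>m k. T m k \<omega> $ j) (x $ j))) \<in> borel_measurable M"
proof (rule measurable_compose_countable'[where I = "S_n n" and g = \<sigma>
      and f = "\<lambda>p \<omega>. s *\<^sub>R (\<chi> j. log_Z n p (\<lambda>m k. T m k \<omega> $ j) (x $ j))"])
  fix p
  have "(\<lambda>\<omega>. Ln (1 - (x $ j) powi (- int (fst q)) * T (fst q) (snd q) \<omega> $ j)) \<in> borel_measurable M"
    if "q \<in> cycle_slots n p" for q j
  proof -
    have [measurable]: "T (fst q) (snd q) \<in> borel_measurable M"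
      using that cycle_slots_subset[of n p] by (intro T) auto
    show ?thesis by measurable
  qed
  then have "(\<lambda>\<omega>. \<chi> j. log_Z n p (\<lambda>m k. T m k \<omega> $ j) (x $ j)) \<in> borel_measurable M"
    unfolding log_Z_cycle_slots by (intro borel_measurable_vec_lambda borel_measurable_sum)
  then show "(\<lambda>\<omega>. s *\<^sub>R (\<chi> j. log_Z n p (\<lambda>m k. T m k \<omega> $ j) (x $ j))) \<in> borel_measurable M"
    by (rule borel_measurable_scaleR[OF borel_measurable_const])
qed (use \<sigma> finite_S_n in \<open>auto intro: countable_finite\<close>)

section \<open>Convergence in law\<close>

theorem proposition1p2:
  fixes \<theta> :: real
    and \<phi> :: "'d::finite \<Rightarrow> real"
    and x :: "complex ^ 'd"
    and Mz :: "'v measure" and z :: "'v \<Rightarrow> complex ^ 'd"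
    and M :: "nat \<Rightarrow> 'w measure"
    and \<sigma> :: "nat \<Rightarrow> 'w \<Rightarrow> (nat \<Rightarrow> nat)"
    and T :: "nat \<Rightarrow> nat \<Rightarrow> nat \<Rightarrow> 'w \<Rightarrow> complex ^ 'd"
    and MN :: "'u measure" and N :: "'u \<Rightarrow> complex ^ 'd"
  assumes theta_pos: "\<theta> > 0"
    and z_space: "prob_space Mz"
    and z_measurable: "z \<in> borel_measurable Mz"
    and z_torus: "\<And>\<omega> j. \<omega> \<in> space Mz \<Longrightarrow> z \<omega> $ j \<in> sphere 0 1"
    and z_uniform: "\<And>j. distr Mz borel (\<lambda>\<omega>. z \<omega> $ j) = uniform_circle"
    and z_indep: "prob_space.indep_vars Mz (\<lambda>_. borel) (\<lambda>j \<omega>. z \<omega> $ j) UNIV"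
    and x_def: "\<And>j. x $ j = exp (2 * of_real pi * \<i> * of_real (\<phi> j))"
    and lin_indep: "\<And>(a0::int) (a :: 'd \<Rightarrow> int).
          of_int a0 * 1 + (\<Sum>j\<in>UNIV. of_int (a j) * \<phi> j) = 0 \<Longrightarrow> a0 = 0 \<and> (\<forall>j. a j = 0)"
    and M_space: "\<And>n. n \<ge> 1 \<Longrightarrow> prob_space (M n)"
    and sigma_measurable: "\<And>n. n \<ge> 1 \<Longrightarrow> \<sigma> n \<in> M n \<rightarrow>\<^sub>M count_space (S_n n)"
    and sigma_ewens: "\<And>n. n \<ge> 1 \<Longrightarrow> distr (M n) (count_space (S_n n)) (\<sigma> n) = ewens \<theta> n"
    and T_law: "\<And>n m k. n \<ge> 1 \<Longrightarrow> m \<ge> 1 \<Longrightarrow> k \<ge> 1 \<Longrightarrow>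
          distr (M n) borel (T n m k) = iid_product_law (distr Mz borel z) m"
    and T_indep: "\<And>n. n \<ge> 1 \<Longrightarrow>
          prob_space.indep_vars (M n) (\<lambda>_. borel) (\<lambda>(m, k). T n m k) ({1..} \<times> {1..})"
    and sigma_T_indep: "\<And>n. n \<ge> 1 \<Longrightarrow>
          indep_rv (M n)
            (count_space (S_n n)) (\<sigma> n)
            (\<Pi>\<^sub>M p\<in>{1..} \<times> {1..}. borel)
            (\<lambda>\<omega>. \<lambda>p\<in>{1..} \<times> {1..}. T n (fst p) (snd p) \<omega>)"
    and N_space: "prob_space MN"
    and N_measurable: "N \<in> borel_measurable MN"
    and N_normal_Re: "\<And>j. distributed MN lborel (\<lambda>\<omega>. Re (N \<omega> $ j)) std_normal_density"
    and N_normal_Im: "\<And>j. distributed MN lborel (\<lambda>\<omega>. Im (N \<omega> $ j)) std_normal_density"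
    and N_indep: "prob_space.indep_vars MN (\<lambda>_. borel)
          (\<lambda>i \<omega>. case i of Inl j \<Rightarrow> Re (N \<omega> $ j) | Inr j \<Rightarrow> Im (N \<omega> $ j))
          (UNIV :: ('d + 'd) set)"
  shows "weakly_converges
           (\<lambda>n. distr (M n) borel
              (\<lambda>\<omega>. (1 / sqrt (pi\<^sup>2 / 12 * \<theta> * ln (real n))) *\<^sub>R
                    (\<chi> j. log_Z n (\<sigma> n \<omega>) (\<lambda>m k. T n m k \<omega> $ j) (x $ j))))
           (distr MN borel N)"
proof -
  define s where "s n = 1 / sqrt (pi\<^sup>2 / 12 * \<theta> * ln (real n))" for n
  define X where "X n \<omega> = s n *\<^sub>R (\<chi> j. log_Z n (\<sigma> n \<omega>) (\<lambda>m k. T n m k \<omega> $ j) (x $ j))" for n \<omega>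
  have \<nu>: "uniform_torus (distr Mz borel z)"
    using z_space z_measurable z_torus z_uniform z_indep by (rule uniform_torusI_indep)
  have x: "norm (x $ j) = 1" for j
    by (simp add: x_def norm_exp_eq_Re)
  have X: "X n \<in> borel_measurable (M n)" if n: "n \<ge> 1" for n
  proof -
    interpret prob_space "M n" using M_space[OF n] .
    have "T n m k \<in> borel_measurable (M n)" if "m \<ge> 1" "k \<ge> 1" for m k
      using T_indep[OF n] that unfolding indep_vars_def by auto
    then show ?thesis
      unfolding X_def by (rule log_Z_vector_measurable[OF sigma_measurable[OF n]])
  qed
  define D where "D n = distr (M n) borel (X n)" for n
  have char_X: "(CLINT y|D n. iexp (t \<bullet> y))
      = pochhammer (of_real \<theta> * (\<Prod>j\<in>UNIV. log_char (t $ j) (s n))) n / of_real (pochhammer \<theta> n)"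
    if n: "n \<ge> 1" for n t
  proof -
    have "(CLINT y|D n. iexp (t \<bullet> y)) = (CLINT \<omega>|M n. iexp (t \<bullet> X n \<omega>))"
      unfolding D_def by (rule integral_distr[OF X[OF n]]) measurable
    also have "\<dots> = pochhammer (of_real \<theta> * (\<Prod>j\<in>UNIV. log_char (t $ j) (s n))) n / of_real (pochhammer \<theta> n)"
      unfolding X_def
      by (rule char_log_Z[OF theta_pos \<nu> x M_space[OF n] sigma_ewens[OF n] T_law[OF n] T_indep[OF n] sigma_T_indep[OF n]])
    finally show ?thesis .
  qed
  \<comment> \<open>Nothing is known about the measure \<open>M 0\<close>, so the sequence is taken from \<open>n = 1\<close> on.\<close>
  have "weakly_converges (\<lambda>n. D (Suc n)) (distr MN borel N)"
  proof (rule levy_continuity_euclidean)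
    show "prob_space (D (Suc n))" for n
      unfolding D_def using M_space X by (intro prob_space.prob_space_distr) auto
    show "prob_space (distr MN borel N)"
      using N_space N_measurable by (rule prob_space.prob_space_distr)
    fix t :: "complex ^ 'd"
    have "(\<lambda>n. CLINT y|D (Suc n). iexp (t \<bullet> y)) \<longlonglongrightarrow> of_real (exp (- (norm t)\<^sup>2 / 2))"
      using LIMSEQ_Suc[OF ewens_char_limit[OF theta_pos, of t]]
      by (simp only: char_X s_def Suc_le_mono One_nat_def le0)
    then show "(\<lambda>n. CLINT y|D (Suc n). iexp (t \<bullet> y)) \<longlonglongrightarrow> (CLINT y|distr MN borel N. iexp (t \<bullet> y))"
      unfolding char_gaussian_vector[OF N_space N_measurable N_normal_Re N_normal_Im N_indep] .
  qed (simp_all add: D_def)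
  then have "weakly_converges D (distr MN borel N)"
    unfolding weakly_converges_def by (auto intro: LIMSEQ_imp_Suc)
  then show ?thesis
    unfolding D_def X_def s_def .
qed

end
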